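(* Let $(G,\kappa)$ be a capacitated graph with $\kappa(x)=1$ for all $x\in V(G)$. Let $X=\{x\in V(G): d_G(x)=1\}$, $Y=N_G(X)\setminus X$ and $Z=V(G)\setminus (X\cup Y)$. Then all $DP$-Nash subgraphs of $(G,\kappa)$ have the same $D$-set if and only if $X\cup Z$ is an independent set in $G$ and $|N_G(y)\cap X|\ge 2$ for all $y\in Y$. In particular, the problem of deciding whether a capacitated graph has a unique $D$-set is in $\mathsf{P}$ when restricted to capacitated graphs in which all capacities equal $1$.
   Context: All graphs are finite, undirected, without loops or parallel edges. A capacitated graph $(G,\kappa)$ is a graph $G$ together with a function $\kappa:V(G)\to\mathbb{Z}_{\ge 0}$. $d_G(v)$ is the degree of $v$ in $G$, $N_G(v)$ its neighbourhood, and $N_G(Q)=\bigcup_{x\in Q}N_G(x)$ for a vertex set $Q$. A $DP$-Nash subgraph (Nash subgraph) of $(G,\kappa)$ is a spanning subgraph $H$ of $G$ that is bipartite with partite sets $D$ and $P$ (called the $D$-set and $P$-set of $H$; one of them may be empty) such that no vertex of $P$ is isolated in $H$ and $d_H(x)=\min\{d_G(x),\kappa(x)\}$ for every $x\in D$. A set $B\subseteq V(G)$ is a $D$-set of $(G,\kappa)$ if $(G,\kappa)$ has a Nash subgraph whose $D$-set is $B$. *)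

theory Defs
  imports "HOL-Computational_Algebra.Polynomial"
begin

definition simple_graph :: "'a set \<Rightarrow> 'a set set \<Rightarrow> bool" where
  "simple_graph V E \<longleftrightarrow> finite V \<and> (\<forall>e\<in>E. e \<subseteq> V \<and> card e = 2)"

definition nbrs :: "'a set set \<Rightarrow> 'a \<Rightarrow> 'a set" where
  "nbrs E v = {u. {u, v} \<in> E}"

definition nbrs_set :: "'a set set \<Rightarrow> 'a set \<Rightarrow> 'a set" where
  "nbrs_set E Q = (\<Union>x\<in>Q. nbrs E x)"

definition vdegree :: "'a set set \<Rightarrow> 'a \<Rightarrow> nat" where
  "vdegree E v = card (nbrs E v)"

definition independent_set :: "'a set set \<Rightarrow> 'a set \<Rightarrow> bool" where
  "independent_set E S \<longleftrightarrow> (\<forall>u\<in>S. \<forall>v\<in>S. {u, v} \<notin> E)"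

text \<open>A spanning subgraph of \<open>(V, E)\<close> is given by its edge set \<open>F \<subseteq> E\<close>.\<close>

definition nash_subgraph ::
  "'a set \<Rightarrow> 'a set set \<Rightarrow> ('a \<Rightarrow> nat) \<Rightarrow> 'a set \<Rightarrow> 'a set \<Rightarrow> 'a set set \<Rightarrow> bool" where
  "nash_subgraph V E \<kappa> D P F \<longleftrightarrow>
     F \<subseteq> E \<and> D \<union> P = V \<and> D \<inter> P = {} \<and>
     (\<forall>e\<in>F. \<exists>u\<in>D. \<exists>v\<in>P. e = {u, v}) \<and>
     (\<forall>v\<in>P. vdegree F v \<noteq> 0) \<and>
     (\<forall>x\<in>D. vdegree F x = min (vdegree E x) (\<kappa> x))"

definition D_set :: "'a set \<Rightarrow> 'a set set \<Rightarrow> ('a \<Rightarrow> nat) \<Rightarrow> 'a set \<Rightarrow> bool" where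
  "D_set V E \<kappa> B \<longleftrightarrow> (\<exists>P F. nash_subgraph V E \<kappa> B P F)"

text \<open>
  The tape alphabet of a machine consists of the blank, the letters of the finite
  input alphabet \<open>'a\<close>, and finitely many work symbols, namely \<open>Work i\<close> with
  \<open>i < work_symbols M\<close>. States are the numbers below \<open>states M\<close>.
  All tapes are infinite in both directions.
\<close>

datatype 'a cell = Blank | Letter 'a | Work nat

datatype move = MoveLeft | Stay | MoveRight

record 'a tm =
  tapes :: nat
  states :: nat
  work_symbols :: nat
  start_state :: nat
  accept_state :: nat
  reject_state :: nat
  transition :: "nat \<Rightarrow> 'a cell list \<Rightarrow> nat \<times> ('a cell \<times> move) list"

definition alphabet :: "'a tm \<Rightarrow> 'a cell set" where
  "alphabet M = {Blank} \<union> range Letter \<union> Work ` {..<work_symbols M}"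

definition wf_tm :: "'a tm \<Rightarrow> bool" where
  "wf_tm M \<longleftrightarrow>
     tapes M \<ge> 1 \<and>
     start_state M < states M \<and> accept_state M < states M \<and> reject_state M < states M \<and>
     accept_state M \<noteq> reject_state M \<and>
     (\<forall>q < states M. \<forall>cs. length cs = tapes M \<and> set cs \<subseteq> alphabet M \<longrightarrow>
        (case transition M q cs of (q', acts) \<Rightarrow>
           q' < states M \<and> length acts = tapes M \<and> fst ` set acts \<subseteq> alphabet M))"

type_synonym 'a tape = "(int \<Rightarrow> 'a cell) \<times> int"

definition read_tape :: "'a tape \<Rightarrow> 'a cell" where
  "read_tape t = fst t (snd t)"

fun move_head :: "move \<Rightarrow> int \<Rightarrow> int" where
  "move_head MoveLeft i = i - 1"
| "move_head Stay i = i"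
| "move_head MoveRight i = i + 1"

fun act_tape :: "'a cell \<times> move \<Rightarrow> 'a tape \<Rightarrow> 'a tape" where
  "act_tape (c, m) (f, i) = (f(i := c), move_head m i)"

type_synonym 'a config = "nat \<times> 'a tape list"

fun tm_step :: "'a tm \<Rightarrow> 'a config \<Rightarrow> 'a config" where
  "tm_step M (q, ts) =
     (if q = accept_state M \<or> q = reject_state M then (q, ts)
      else case transition M q (map read_tape ts) of
             (q', acts) \<Rightarrow> (q', map2 act_tape acts ts))"

definition blank_tape :: "'a tape" where
  "blank_tape = (\<lambda>_. Blank, 0)"

definition input_tape :: "'a list \<Rightarrow> 'a tape" where
  "input_tape w =
     (\<lambda>i. if 0 \<le> i \<and> i < int (length w) then Letter (w ! nat i) else Blank, 0)"

definition init_config :: "'a tm \<Rightarrow> 'a list \<Rightarrow> 'a config" where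
  "init_config M w = (start_state M, input_tape w # replicate (tapes M - 1) blank_tape)"

definition decides_in_time :: "'a tm \<Rightarrow> 'a list set \<Rightarrow> (nat \<Rightarrow> nat) \<Rightarrow> bool" where
  "decides_in_time M L T \<longleftrightarrow>
     (\<forall>w. \<exists>t \<le> T (length w).
        fst ((tm_step M ^^ t) (init_config M w)) =
          (if w \<in> L then accept_state M else reject_state M))"

definition in_P :: "'a::finite list set \<Rightarrow> bool" where
  "in_P L \<longleftrightarrow> (\<exists>M (p :: nat poly). wf_tm M \<and> decides_in_time M L (poly p))"

datatype letter = Bit bool | Sep

instance letter :: finite
proof
  have "UNIV = insert Sep (range Bit)"
    by (metis UNIV_eq_I insertCI letter.exhaust rangeI)
  thus "finite (UNIV :: letter set)"
    by (metis finite_code finite_imageI finite_insert)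
qed

text \<open>Binary notation, least significant bit first and without leading zeros;
  0 is the empty word.\<close>

fun binary :: "nat \<Rightarrow> bool list" where
  "binary n = (if n = 0 then [] else odd n # binary (n div 2))"

declare binary.simps [simp del]

text \<open>
  A capacitated graph with vertex set \<open>{..<n}\<close> is written down vertex by vertex:
  the row of the adjacency matrix followed by the capacity in binary, each closed by
  a separator. Every finite graph is isomorphic to one with such a vertex set.
\<close>

definition encode :: "nat \<Rightarrow> nat set set \<Rightarrow> (nat \<Rightarrow> nat) \<Rightarrow> letter list" where
  "encode n E \<kappa> =
     concat (map (\<lambda>v. map (\<lambda>u. Bit ({u, v} \<in> E)) [0..<n] @ [Sep] @
                      map Bit (binary (\<kappa> v)) @ [Sep]) [0..<n])"

end

theory Submission
  imports Defs
begin

text \<open>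
  With all capacities equal to 1, a Nash subgraph is a spanning forest of stars: the centres are
  the \<open>P\<close>-vertices, every star has at least one further vertex, and those, together with the
  isolated vertices of the graph, form the \<open>D\<close>-set. Such a forest always exists: in a
  smallest edge cover each edge has an endpoint that no other edge covers
  (\<open>nash_subgraph_exists\<close>).

  Uniqueness fails exactly at an edge \<open>uv\<close> that no leaf other than \<open>u\<close>, \<open>v\<close> is attached to.
  The vertices that become isolated when such \<open>u\<close> and \<open>v\<close> are deleted are adjacent to both of
  them, so they can all be hung on \<open>u\<close>, or all on \<open>v\<close>, and the rest of the graph has a star
  forest of its own; hence \<open>u\<close> is a centre in one solution and not in another
  (\<open>nash_subgraph_with_edge_centre\<close>). Call a graph rigid if every edge has a leaf outside
  it attached to one of its ends. Uniqueness thus implies rigidity, rigidity gives the condition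
  on \<open>X\<close>, \<open>Y\<close>, \<open>Z\<close>, and under that condition the \<open>D\<close>-set is forced to be \<open>X \<union> Z\<close>: a vertex
  of \<open>Y\<close> in \<open>D\<close> would have to serve two leaves with a single edge.

  Rigidity is a first-order property of the adjacency matrix, and this gives the polynomial
  bound. Formulas over the positions of the input word, with polynomials in the quantified
  positions as terms, are evaluated by nested loops whose counters are head positions of a
  multi-tape machine (\<open>in_P_by_formula\<close>, on top of \<open>in_P_by_program\<close>). The words that encode a
  rigid graph with unit capacities are defined by one such formula (\<open>graph_word_iff\<close>,
  \<open>sat_unique_D_set_fm\<close>).
\<close>

section \<open>Unit capacities: star forests and rigid graphs\<close>

lemma nbrs_sym: "u \<in> nbrs E v \<longleftrightarrow> v \<in> nbrs E u"
  by (simp add: nbrs_def insert_commute)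

lemma nbrs_mono: "F \<subseteq> E \<Longrightarrow> nbrs F v \<subseteq> nbrs E v"
  by (auto simp: nbrs_def)

lemma simple_graph_edgeD:
  assumes "simple_graph V E" "{u, v} \<in> E"
  shows "u \<in> V" "v \<in> V" "u \<noteq> v"
proof -
  have "{u, v} \<subseteq> V" "card {u, v} = 2"
    using assms unfolding simple_graph_def by blast+
  thus "u \<in> V" "v \<in> V" "u \<noteq> v" by auto
qed

lemma simple_graph_edgeE:
  assumes "simple_graph V E" "e \<in> E" "u \<in> e"
  obtains v where "e = {u, v}" "u \<noteq> v"
proof -
  have "card e = 2" using assms by (auto simp: simple_graph_def)
  then obtain a b where "e = {a, b}" "a \<noteq> b" by (auto simp: card_2_iff)
  thus thesis using that assms(3) by (cases "u = a") (auto simp: insert_commute)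
qed

lemma finite_nbrs:
  assumes "simple_graph V E"
  shows "finite (nbrs E v)"
proof (rule finite_subset)
  show "nbrs E v \<subseteq> V"
    using simple_graph_edgeD(1)[OF assms] by (auto simp: nbrs_def)
  show "finite V" using assms by (simp add: simple_graph_def)
qed

lemma simple_graph_subgraph: "simple_graph V E \<Longrightarrow> F \<subseteq> E \<Longrightarrow> simple_graph V F"
  by (auto simp: simple_graph_def)

text \<open>
  For capacity 1 the minimum of degree and capacity is 0 at an isolated vertex and 1 at
  any other. This is the form in which Nash subgraphs are used below: star forests with their
  centres in \<open>P\<close>.
\<close>

lemma nash_subgraph_unit_iff:
  assumes G: "simple_graph V E" and cap: "\<forall>x\<in>V. \<kappa> x = 1"
  shows "nash_subgraph V E \<kappa> D P F \<longleftrightarrow>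
     F \<subseteq> E \<and> D \<union> P = V \<and> D \<inter> P = {} \<and>
     (\<forall>e\<in>F. \<exists>u\<in>D. \<exists>v\<in>P. e = {u, v}) \<and>
     (\<forall>v\<in>P. nbrs F v \<noteq> {}) \<and>
     (\<forall>x\<in>D. nbrs E x \<noteq> {} \<longrightarrow> (\<exists>p. nbrs F x = {p}))"
proof -
  have deg: "vdegree F x = min (vdegree E x) (\<kappa> x) \<longleftrightarrow>
      (nbrs E x \<noteq> {} \<longrightarrow> (\<exists>p. nbrs F x = {p}))" if "F \<subseteq> E" "x \<in> V" for x
  proof (cases "nbrs E x = {}")
    case True
    moreover from this have "nbrs F x = {}" using nbrs_mono[OF that(1), of x] by auto
    ultimately show ?thesis by (simp add: vdegree_def)
  next
    case False
    hence "min (vdegree E x) (\<kappa> x) = 1"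
      using cap that(2) finite_nbrs[OF G, of x] by (simp add: vdegree_def Suc_le_eq card_gt_0_iff)
    thus ?thesis using False by (simp add: vdegree_def card_1_singleton_iff)
  qed
  have cov: "vdegree F v \<noteq> 0 \<longleftrightarrow> nbrs F v \<noteq> {}" if "F \<subseteq> E" for v
    using finite_nbrs[OF simple_graph_subgraph[OF G that]] by (simp add: vdegree_def)
  show ?thesis
  proof (cases "F \<subseteq> E \<and> D \<union> P = V")
    case True
    hence "(\<forall>x\<in>D. vdegree F x = min (vdegree E x) (\<kappa> x)) \<longleftrightarrow>
        (\<forall>x\<in>D. nbrs E x \<noteq> {} \<longrightarrow> (\<exists>p. nbrs F x = {p}))"
      by (intro ball_cong refl deg) auto
    thus ?thesis using True cov unfolding nash_subgraph_def by simp
  next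
    case False
    thus ?thesis unfolding nash_subgraph_def by blast
  qed
qed

text \<open>
  A smallest edge cover of the non-isolated vertices is a star forest: removing an edge would
  uncover one of its endpoints, and that endpoint can be put into \<open>D\<close>. If both endpoints of an
  edge are private to it, the choice is arbitrary.
\<close>

lemma nash_subgraph_exists:
  assumes G: "simple_graph V E" and cap: "\<forall>x\<in>V. \<kappa> x = 1"
  shows "\<exists>D P F. nash_subgraph V E \<kappa> D P F"
proof -
  define cover where
    "cover F \<longleftrightarrow> F \<subseteq> E \<and> (\<forall>v. nbrs E v \<noteq> {} \<longrightarrow> nbrs F v \<noteq> {})" for F
  have finE: "finite E"
    using G by (intro finite_subset[of E "Pow V"]) (auto simp: simple_graph_def)
  have "cover E" by (simp add: cover_def)
  then obtain F where F: "cover F" and minimal: "\<And>F'. cover F' \<Longrightarrow> card F \<le> card F'"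
    using ex_has_least_nat[of cover E card] by blast
  have FE: "F \<subseteq> E" using F by (simp add: cover_def)
  have finF: "finite F" using FE finE by (rule finite_subset)
  have "\<exists>c. c \<in> e \<and> (\<forall>e'\<in>F. c \<in> e' \<longrightarrow> e' = e)" if "e \<in> F" for e
  proof -
    have "\<not> cover (F - {e})"
      using minimal[of "F - {e}"] card_Diff1_less[OF finF that] by linarith
    then obtain v where v: "nbrs E v \<noteq> {}" "nbrs (F - {e}) v = {}"
      using FE by (auto simp: cover_def)
    have only: "e' = e" if e': "e' \<in> F" "v \<in> e'" for e'
    proof -
      have "e' \<in> E" using e' FE by blast
      then obtain u where "e' = {v, u}" using e'(2) by (rule simple_graph_edgeE[OF G])
      thus ?thesis using v(2) e'(1) by (auto simp: nbrs_def insert_commute)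
    qed
    obtain u where "{u, v} \<in> F" using F v(1) by (auto simp: cover_def nbrs_def)
    hence "v \<in> e" using only[of "{u, v}"] by auto
    thus ?thesis using only by blast
  qed
  then obtain c where c: "\<And>e. e \<in> F \<Longrightarrow> c e \<in> e"
      and priv: "\<And>e e'. e \<in> F \<Longrightarrow> e' \<in> F \<Longrightarrow> c e \<in> e' \<Longrightarrow> e' = e"
    by metis
  define D where "D = c ` F \<union> {v \<in> V. nbrs E v = {}}"
  have cV: "c e \<in> V" if "e \<in> F" for e
    using c[OF that] that FE G by (auto simp: simple_graph_def)
  have "nash_subgraph V E \<kappa> D (V - D) F"
    unfolding nash_subgraph_unit_iff[OF G cap]
  proof (intro conjI ballI impI)
    show "F \<subseteq> E" by (fact FE)
    show "D \<union> (V - D) = V" using cV by (auto simp: D_def)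
    show "D \<inter> (V - D) = {}" by auto
  next
    fix e assume e: "e \<in> F"
    then obtain p where p: "e = {c e, p}" "c e \<noteq> p"
      using simple_graph_edgeE[OF G _ c[OF e]] FE by blast
    have pe: "p \<in> e" and cp: "{c e, p} \<in> F" "{p, c e} \<in> F"
      subgoal by (subst p(1)) simp
      subgoal by (subst p(1)[symmetric]) (rule e)
      subgoal by (subst insert_commute, subst p(1)[symmetric]) (rule e)
      done
    have "p \<notin> D"
    proof
      assume "p \<in> D"
      thus False
      proof (unfold D_def, elim UnE imageE)
        fix e' assume "p = c e'" "e' \<in> F"
        thus False using priv[of e' e] e pe p(2) by simp
      next
        assume "p \<in> {v \<in> V. nbrs E v = {}}"
        moreover have "c e \<in> nbrs E p" using cp(1) FE by (auto simp: nbrs_def)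
        ultimately show False by auto
      qed
    qed
    moreover have "p \<in> V" using simple_graph_edgeD(2)[OF G, of "c e" p] cp(1) FE by blast
    moreover have "c e \<in> D" using e by (simp add: D_def)
    ultimately have ce: "c e \<in> D" and pD: "p \<in> V - D" using \<open>p \<notin> D\<close> by blast+
    have "\<exists>v\<in>V - D. e = {c e, v}" using p(1) pD by (rule bexI)
    thus "\<exists>u\<in>D. \<exists>v\<in>V - D. e = {u, v}" using ce by (rule bexI)
  next
    fix v assume "v \<in> V - D"
    thus "nbrs F v \<noteq> {}" using F by (auto simp: cover_def D_def)
  next
    fix x assume "x \<in> D" "nbrs E x \<noteq> {}"
    then obtain e where e: "e \<in> F" "x = c e" by (auto simp: D_def)
    then obtain p where p: "e = {x, p}" "x \<noteq> p"
      using simple_graph_edgeE[OF G _ c[OF e(1)]] FE e(1) by (metis e(2) subsetD)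
    have "u = p" if "u \<in> nbrs F x" for u
    proof -
      have "{u, x} = e" using priv[of e "{u, x}"] that e by (simp add: nbrs_def)
      hence "{u, x} = {x, p}" using p(1) by (rule trans)
      thus ?thesis using p(2) by (auto simp: doubleton_eq_iff)
    qed
    moreover have "{x, p} \<in> F" using e(1) p(1) by (rule subst[rotated])
    hence "p \<in> nbrs F x" by (simp add: nbrs_def insert_commute)
    ultimately show "\<exists>p. nbrs F x = {p}" by blast
  qed
  thus ?thesis by blast
qed

definition leaf :: "'a set set \<Rightarrow> 'a \<Rightarrow> bool" where
  "leaf E x \<longleftrightarrow> (\<exists>y. nbrs E x = {y})"

lemma vdegree_1_iff_leaf: "vdegree E x = 1 \<longleftrightarrow> leaf E x"
  by (simp add: vdegree_def leaf_def card_1_singleton_iff)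

text \<open>
  Delete \<open>u\<close>, \<open>v\<close> and the set \<open>W\<close> of the other non-isolated vertices whose neighbours all lie in
  \<open>{u, v}\<close>. No further vertex becomes isolated, so a star forest of what remains can be completed by the star with
  centre \<open>u\<close> and the vertices of \<open>W \<union> {v}\<close> around it. The assumption on leaves makes every vertex
  of \<open>W\<close> adjacent to \<open>u\<close>; as it is symmetric in \<open>u\<close> and \<open>v\<close>, the roles can be exchanged.
\<close>

lemma nash_subgraph_with_edge_centre:
  assumes G: "simple_graph V E" and cap: "\<forall>x\<in>V. \<kappa> x = 1"
    and uv: "{u, v} \<in> E"
    and free: "\<And>x. leaf E x \<Longrightarrow> x \<noteq> u \<Longrightarrow> x \<noteq> v \<Longrightarrow> {x, u} \<notin> E \<and> {x, v} \<notin> E"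
  shows "\<exists>D P F. nash_subgraph V E \<kappa> D P F \<and> u \<in> P \<and> v \<in> D"
proof -
  define W where "W = {x \<in> V - {u, v}. nbrs E x \<noteq> {} \<and> nbrs E x \<subseteq> {u, v}}"
  define V' where "V' = V - {u, v} - W"
  define E' where "E' = {e \<in> E. e \<subseteq> V'}"
  have uvV: "u \<in> V" "v \<in> V" "u \<noteq> v" using simple_graph_edgeD[OF G uv] by auto
  have W: "{x, u} \<in> E" if "x \<in> W" for x
  proof (rule ccontr)
    assume "{x, u} \<notin> E"
    hence "u \<notin> nbrs E x" by (simp add: nbrs_def insert_commute)
    hence nx: "nbrs E x = {v}" using that by (auto simp: W_def)
    hence "leaf E x" by (auto simp: leaf_def)
    moreover have "{x, v} \<in> E" using nx by (auto simp: nbrs_def insert_commute)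
    ultimately show False using free[of x] that by (auto simp: W_def)
  qed
  have G': "simple_graph V' E'"
    using G by (auto simp: simple_graph_def V'_def E'_def)
  moreover have cap': "\<forall>x\<in>V'. \<kappa> x = 1" using cap by (auto simp: V'_def)
  ultimately obtain D' P' F' where nash': "nash_subgraph V' E' \<kappa> D' P' F'"
    using nash_subgraph_exists by blast
  hence N': "F' \<subseteq> E'" "D' \<union> P' = V'" "D' \<inter> P' = {}"
      "\<And>e. e \<in> F' \<Longrightarrow> \<exists>u\<in>D'. \<exists>v\<in>P'. e = {u, v}"
      "\<And>v. v \<in> P' \<Longrightarrow> nbrs F' v \<noteq> {}"
      "\<And>x. x \<in> D' \<Longrightarrow> nbrs E' x \<noteq> {} \<Longrightarrow> \<exists>p. nbrs F' x = {p}"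
    unfolding nash_subgraph_unit_iff[OF G' cap'] by auto
  define D where "D = D' \<union> insert v W"
  define P where "P = insert u P'"
  define F where "F = F' \<union> (\<lambda>x. {x, u}) ` insert v W"
  have F'V: "a \<in> V'" "b \<in> V'" if "{a, b} \<in> F'" for a b
    using that N'(1) by (auto simp: E'_def)
  have F_iff: "{y, x} \<in> F \<longleftrightarrow> {y, x} \<in> F' \<or> y \<in> insert v W \<and> x = u \<or> x \<in> insert v W \<and> y = u" for x y
    unfolding F_def by (auto simp: doubleton_eq_iff)
  have V'_out: "x \<noteq> u" "x \<notin> insert v W" if "x \<in> V'" for x
    using that by (auto simp: V'_def)
  have u_out: "u \<notin> insert v W" using uvV by (auto simp: W_def)
  have nbrs_V': "nbrs F x = nbrs F' x" if "x \<in> V'" for x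
    using V'_out[OF that] by (simp add: nbrs_def F_iff)
  have nbrs_W: "nbrs F x = {u}" if x: "x \<in> insert v W" for x
  proof -
    have "{y, x} \<notin> F'" for y using F'V(2)[of y x] V'_out(2)[of x] x by blast
    moreover have "x \<noteq> u" using x u_out by blast
    ultimately show ?thesis using x unfolding nbrs_def F_iff by simp
  qed
  \<comment> \<open>a neighbour outside \<open>{u, v}\<close> cannot lie in \<open>W\<close>, so it survives the deletion\<close>
  have nonisolated: "nbrs E' x \<noteq> {}" if x: "x \<in> V'" "nbrs E x \<noteq> {}" for x
  proof -
    have "x \<notin> {u, v}" "x \<notin> W" using x by (auto simp: V'_def)
    hence "\<not> nbrs E x \<subseteq> {u, v}" using x by (auto simp: W_def V'_def)
    then obtain y where y: "{y, x} \<in> E" "y \<notin> {u, v}" by (auto simp: nbrs_def)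
    have "y \<notin> W"
    proof
      assume "y \<in> W"
      moreover have "x \<in> nbrs E y" using y(1) by (simp add: nbrs_def insert_commute)
      ultimately show False using \<open>x \<notin> {u, v}\<close> by (auto simp: W_def)
    qed
    hence "y \<in> V'" using y simple_graph_edgeD(1)[OF G y(1)] by (auto simp: V'_def)
    thus ?thesis using x(1) y(1) by (auto simp: nbrs_def E'_def)
  qed
  have "nash_subgraph V E \<kappa> D P F"
    unfolding nash_subgraph_unit_iff[OF G cap]
  proof (intro conjI ballI impI)
    show "F \<subseteq> E" using N'(1) W uv by (auto simp: F_def E'_def insert_commute)
    show "D \<union> P = V" using N'(2) uvV by (auto simp: D_def P_def V'_def W_def)
    show "D \<inter> P = {}" using N'(2,3) uvV by (auto simp: D_def P_def V'_def W_def)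
  next
    fix e assume "e \<in> F"
    thus "\<exists>u\<in>D. \<exists>v\<in>P. e = {u, v}"
      using N'(4)[of e] by (auto simp: F_def D_def P_def)
  next
    fix p assume p: "p \<in> P"
    show "nbrs F p \<noteq> {}"
    proof (cases "p = u")
      case True
      have "v \<in> nbrs F u" using nbrs_W[of v] nbrs_sym[of u F v] by simp
      thus ?thesis using True by auto
    next
      case False
      thus ?thesis using p N'(2,5) nbrs_V'[of p] by (auto simp: P_def)
    qed
  next
    fix x assume "x \<in> D" "nbrs E x \<noteq> {}"
    thus "\<exists>p. nbrs F x = {p}"
      using nbrs_W[of x] nbrs_V'[of x] nonisolated[of x] N'(2,6)
      by (auto simp: D_def)
  qed
  moreover have "u \<in> P" "v \<in> D" by (auto simp: P_def D_def)
  ultimately show ?thesis by iprover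
qed

text \<open>
  The negation of the assumption of \<open>nash_subgraph_with_edge_centre\<close>, required of every edge. In
  contrast to the condition on \<open>X\<close>, \<open>Y\<close> and \<open>Z\<close> it involves no counting, which is why the machine
  below decides this form.
\<close>

definition rigid :: "'a set set \<Rightarrow> bool" where
  "rigid E \<longleftrightarrow> (\<forall>u v. {u, v} \<in> E \<longrightarrow>
     (\<exists>x. x \<noteq> u \<and> x \<noteq> v \<and> leaf E x \<and> ({x, u} \<in> E \<or> {x, v} \<in> E)))"

lemma unique_D_set_imp_rigid:
  assumes G: "simple_graph V E" and cap: "\<forall>x\<in>V. \<kappa> x = 1"
    and unique: "\<And>D P F D' P' F'. nash_subgraph V E \<kappa> D P F \<Longrightarrow>
       nash_subgraph V E \<kappa> D' P' F' \<Longrightarrow> D = D'"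
  shows "rigid E"
proof (rule ccontr)
  assume "\<not> rigid E"
  then obtain u v where uv: "{u, v} \<in> E" and
    free: "\<And>x. leaf E x \<Longrightarrow> x \<noteq> u \<Longrightarrow> x \<noteq> v \<Longrightarrow> {x, u} \<notin> E \<and> {x, v} \<notin> E"
    unfolding rigid_def by blast
  obtain D P F where 1: "nash_subgraph V E \<kappa> D P F" "u \<in> P"
    using nash_subgraph_with_edge_centre[OF G cap uv free] by blast
  have vu: "{v, u} \<in> E" using uv by (simp add: insert_commute)
  have "\<exists>D P F. nash_subgraph V E \<kappa> D P F \<and> v \<in> P \<and> u \<in> D"
    by (rule nash_subgraph_with_edge_centre[OF G cap vu]) (simp add: free)
  then obtain D' P' F' where 2: "nash_subgraph V E \<kappa> D' P' F'" "u \<in> D'"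
    by blast
  from 1 2 show False using unique[OF 1(1) 2(1)] by (auto simp: nash_subgraph_def)
qed

text \<open>
  For an edge \<open>uv\<close> inside \<open>X \<union> Z\<close>, a leaf \<open>x\<close> attached to \<open>u\<close> puts \<open>u\<close> among the neighbours of
  \<open>X\<close>, hence into \<open>X\<close>; but then \<open>u\<close> is a leaf with the two neighbours \<open>x\<close> and \<open>v\<close>. For
  \<open>y \<in> Y\<close> with an attached leaf \<open>x\<close>, the leaf that rigidity provides for the edge \<open>xy\<close> cannot
  hang on \<open>x\<close>, so it is a second one at \<open>y\<close>.
\<close>

lemma rigid_imp_leaf_condition:
  assumes G: "simple_graph V E" and rigid: "rigid E"
    and X: "X = {x \<in> V. vdegree E x = 1}" and Y: "Y = nbrs_set E X - X"
    and Z: "Z = V - (X \<union> Y)"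
  shows "independent_set E (X \<union> Z)" "\<forall>y\<in>Y. card (nbrs E y \<inter> X) \<ge> 2"
proof -
  have X': "x \<in> X \<longleftrightarrow> x \<in> V \<and> leaf E x" for x
    unfolding X vdegree_1_iff_leaf by simp
  have leaf_eq: "a = b" if x: "leaf E x" "{x, a} \<in> E" "{x, b} \<in> E" for x a b
  proof -
    obtain y where "nbrs E x = {y}" using x(1) by (auto simp: leaf_def)
    moreover have "a \<in> nbrs E x" "b \<in> nbrs E x"
      using x by (auto simp: nbrs_def insert_commute)
    ultimately show ?thesis by auto
  qed
  show "independent_set E (X \<union> Z)"
    unfolding independent_set_def
  proof (intro ballI notI)
    fix u v assume u: "u \<in> X \<union> Z" and v: "v \<in> X \<union> Z" and uv: "{u, v} \<in> E"
    have uv': "{v, u} \<in> E" using uv by (simp add: insert_commute)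
    obtain x where x: "x \<noteq> u" "x \<noteq> v" "leaf E x" "{x, u} \<in> E \<or> {x, v} \<in> E"
      using rigid uv unfolding rigid_def by blast
    have *: "a = u \<or> a = v \<Longrightarrow> {x, a} \<in> E \<Longrightarrow> a \<in> X" for a
    proof -
      assume a: "a = u \<or> a = v" "{x, a} \<in> E"
      hence "x \<in> X" using X' x(3) simple_graph_edgeD(1)[OF G] by blast
      moreover have "{a, x} \<in> E" using a by (simp add: insert_commute)
      ultimately have "a \<in> nbrs_set E X" by (auto simp: nbrs_set_def nbrs_def)
      thus "a \<in> X" using a(1) u v by (auto simp: Y Z)
    qed
    from x(4) show False
    proof
      assume a: "{x, u} \<in> E"
      hence "leaf E u" using *[of u] X' by simp
      thus False using leaf_eq[of u x v] a uv x(2) by (auto simp: insert_commute)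
    next
      assume a: "{x, v} \<in> E"
      hence "leaf E v" using *[of v] X' by simp
      thus False using leaf_eq[of v x u] a uv x(1) by (auto simp: insert_commute)
    qed
  qed
  show "\<forall>y\<in>Y. card (nbrs E y \<inter> X) \<ge> 2"
  proof
    fix y assume y: "y \<in> Y"
    then obtain x where x: "x \<in> X" "{y, x} \<in> E" by (auto simp: Y nbrs_set_def nbrs_def)
    have xy: "{x, y} \<in> E" using x by (simp add: insert_commute)
    obtain z where z: "z \<noteq> x" "z \<noteq> y" "leaf E z" "{z, x} \<in> E \<or> {z, y} \<in> E"
      using rigid xy unfolding rigid_def by blast
    have "{z, x} \<notin> E"
      using leaf_eq[of x y z] x X' xy z(2) by (auto simp: insert_commute)
    hence zy: "{z, y} \<in> E" using z(4) by blast
    have "z \<in> X" using X' z(3) simple_graph_edgeD(1)[OF G zy] by simp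
    hence sub: "{x, z} \<subseteq> nbrs E y \<inter> X" using x(1) xy zy by (auto simp: nbrs_def)
    have "card {x, z} = 2" using z(1) by simp
    thus "card (nbrs E y \<inter> X) \<ge> 2"
      using card_mono[OF _ sub] finite_nbrs[OF G, of y] by simp
  qed
qed

text \<open>
  If some \<open>y \<in> Y\<close> were in \<open>D\<close>, each of its leaves would have to be attached to \<open>y\<close>: a leaf in \<open>D\<close>
  has no other neighbour to choose, and a leaf in \<open>P\<close> no other neighbour to be chosen by. With
  two leaves this contradicts the single edge at \<open>y\<close>. So \<open>Y \<subseteq> P\<close>, and a vertex of the independent
  set \<open>X \<union> Z\<close> then has no neighbour in \<open>D\<close> and cannot be in \<open>P\<close>.
\<close>

lemma leaf_condition_imp_D_set:
  assumes G: "simple_graph V E" and cap: "\<forall>x\<in>V. \<kappa> x = 1"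
    and X: "X = {x \<in> V. vdegree E x = 1}" and Y: "Y = nbrs_set E X - X"
    and Z: "Z = V - (X \<union> Y)"
    and ind: "independent_set E (X \<union> Z)" and two: "\<forall>y\<in>Y. card (nbrs E y \<inter> X) \<ge> 2"
    and nash: "nash_subgraph V E \<kappa> D P F"
  shows "D = X \<union> Z"
proof -
  have N: "F \<subseteq> E" "D \<union> P = V" "D \<inter> P = {}"
      "\<And>e. e \<in> F \<Longrightarrow> \<exists>u\<in>D. \<exists>v\<in>P. e = {u, v}"
      "\<And>v. v \<in> P \<Longrightarrow> nbrs F v \<noteq> {}"
      "\<And>x. x \<in> D \<Longrightarrow> nbrs E x \<noteq> {} \<Longrightarrow> \<exists>p. nbrs F x = {p}"
    using nash unfolding nash_subgraph_unit_iff[OF G cap] by auto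
  have cross: "(a \<in> D \<and> b \<in> P) \<or> (a \<in> P \<and> b \<in> D)" if "{a, b} \<in> F" for a b
    using N(4)[OF that] by (auto simp: doubleton_eq_iff)
  have YV: "Y \<subseteq> V"
    using simple_graph_edgeD(1)[OF G] by (auto simp: Y nbrs_set_def nbrs_def)
  have XV: "X \<subseteq> V" by (auto simp: X)
  have YP: "Y \<subseteq> P"
  proof
    fix y assume y: "y \<in> Y"
    have "y \<notin> D"
    proof
      assume yD: "y \<in> D"
      have attached: "x \<in> nbrs F y" if x: "x \<in> nbrs E y \<inter> X" for x
      proof -
        have "leaf E x" using x unfolding X vdegree_1_iff_leaf by auto
        moreover have "y \<in> nbrs E x" using x nbrs_sym[of x E y] by auto
        ultimately have nx: "nbrs E x = {y}" by (auto simp: leaf_def)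
        hence nF: "nbrs F x \<subseteq> {y}" using nbrs_mono[OF N(1), of x] by simp
        have "x \<in> V" using x XV by auto
        moreover have "nbrs F x \<noteq> {}" if "x \<in> D" using N(6)[OF that] nx by auto
        ultimately have "nbrs F x = {y}" using N(2,5) nF by blast
        thus ?thesis using nbrs_sym[of x F y] by simp
      qed
      have "2 \<le> card (nbrs E y \<inter> X)" using two y by blast
      hence "nbrs E y \<inter> X \<noteq> {}" by (metis card.empty not_numeral_le_zero)
      hence "nbrs E y \<noteq> {}" by auto
      then obtain p where "nbrs F y = {p}" using N(6)[OF yD] by blast
      hence "nbrs E y \<inter> X \<subseteq> {p}" using attached by blast
      hence "card (nbrs E y \<inter> X) \<le> 1" using card_mono[of "{p}"] by fastforce
      thus False using two y by fastforce
    qed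
    thus "y \<in> P" using N(2) YV y by blast
  qed
  have "a \<notin> P" if a: "a \<in> X \<union> Z" for a
  proof
    assume aP: "a \<in> P"
    then obtain b where b: "{b, a} \<in> F" using N(5)[OF aP] by (auto simp: nbrs_def)
    hence bD: "b \<in> D" using cross[OF b] aP N(3) by blast
    hence "b \<in> X \<union> Z" using YP N(2,3) by (auto simp: Z)
    thus False using ind a b N(1) unfolding independent_set_def by blast
  qed
  thus ?thesis using YP N(2,3) XV Z by blast
qed

theorem unique_D_set_iff_leaf_condition:
  assumes G: "simple_graph V E" and cap: "\<forall>x\<in>V. \<kappa> x = 1"
    and X: "X = {x \<in> V. vdegree E x = 1}" and Y: "Y = nbrs_set E X - X"
    and Z: "Z = V - (X \<union> Y)"
  shows "(\<forall>D P F D' P' F'. nash_subgraph V E \<kappa> D P F \<and> nash_subgraph V E \<kappa> D' P' F' \<longrightarrow> D = D') \<longleftrightarrow>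
       independent_set E (X \<union> Z) \<and> (\<forall>y\<in>Y. card (nbrs E y \<inter> X) \<ge> 2)"
    (is "?U \<longleftrightarrow> ?C")
proof
  assume ?U
  hence "rigid E" by (intro unique_D_set_imp_rigid[OF G cap]) blast
  thus ?C using rigid_imp_leaf_condition[OF G _ X Y Z] by blast
next
  assume ?C
  thus ?U using leaf_condition_imp_D_set[OF G cap X Y Z] by metis
qed

lemma ex1_D_set_iff_rigid:
  assumes G: "simple_graph V E" and cap: "\<forall>x\<in>V. \<kappa> x = 1"
  shows "(\<exists>!B. D_set V E \<kappa> B) \<longleftrightarrow> rigid E"
proof
  assume "\<exists>!B. D_set V E \<kappa> B"
  thus "rigid E"
    by (intro unique_D_set_imp_rigid[OF G cap]) (auto simp: D_set_def)
next
  assume "rigid E"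
  hence "\<And>D P F D' P' F'. nash_subgraph V E \<kappa> D P F \<Longrightarrow> nash_subgraph V E \<kappa> D' P' F' \<Longrightarrow> D = D'"
    using unique_D_set_iff_leaf_condition[OF G cap refl refl refl]
      rigid_imp_leaf_condition[OF G _ refl refl refl] by blast
  thus "\<exists>!B. D_set V E \<kappa> B"
    using nash_subgraph_exists[OF G cap] unfolding D_set_def by blast
qed

section \<open>Turing machines from counter programs\<close>

subsection \<open>Machines with an arbitrary finite set of control states\<close>

type_synonym ('s, 'a) control = "'s \<Rightarrow> 'a cell list \<Rightarrow> 's \<times> ('a cell \<times> move) list"

definition ctl_step :: "('s, 'a) control \<Rightarrow> 's \<times> 'a tape list \<Rightarrow> 's \<times> 'a tape list" where
  "ctl_step \<delta> c = (case \<delta> (fst c) (map read_tape (snd c)) of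
     (s', acts) \<Rightarrow> (s', map2 act_tape acts (snd c)))"

lemma ctl_step_eq:
  "ctl_step \<delta> (s, ts) = (case \<delta> s (map read_tape ts) of
     (s', acts) \<Rightarrow> (s', map2 act_tape acts ts))"
  by (simp add: ctl_step_def)

text \<open>
  Lets a machine be described with control states of any type, as long as finitely many of them
  are closed under the transition function; numbering those gives a machine whose states are
  natural numbers.
\<close>

lemma in_P_by_control:
  fixes \<delta> :: "('s, 'a::finite) control" and p :: "nat poly"
  assumes fin: "finite S" and k: "k \<ge> 1"
    and S: "s0 \<in> S" "yes \<in> S" "no \<in> S" "yes \<noteq> no"
    and closed: "\<And>s cs. s \<in> S \<Longrightarrow> length cs = k \<Longrightarrow> set cs \<subseteq> {Blank} \<union> range Letter \<union> Work ` {..<b} \<Longrightarrow>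
       fst (\<delta> s cs) \<in> S \<and> length (snd (\<delta> s cs)) = k \<and>
       fst ` set (snd (\<delta> s cs)) \<subseteq> {Blank} \<union> range Letter \<union> Work ` {..<b}"
    and halt: "\<And>s ts. s = yes \<or> s = no \<Longrightarrow> fst (ctl_step \<delta> (s, ts)) = s"
    and run: "\<And>w. \<exists>t \<le> poly p (length w).
       fst ((ctl_step \<delta> ^^ t) (s0, input_tape w # replicate (k - 1) blank_tape)) =
       (if w \<in> L then yes else no)"
  shows "in_P L"
proof -
  obtain f where f: "bij_betw f S {..<card S}"
    using ex_bij_betw_finite_nat[OF fin] by (auto simp: atLeast0LessThan)
  define g where "g = inv_into S f"
  have gf: "g (f s) = s" if "s \<in> S" for s
    using f that by (simp add: g_def bij_betw_def)
  have gS: "g q \<in> S" and fg: "f (g q) = q" if "q < card S" for q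
    using f that by (auto simp: g_def bij_betw_def f_inv_into_f inv_into_into)
  have fS: "f s < card S" if "s \<in> S" for s
    using f that by (auto simp: bij_betw_def)
  have finj: "f s = f s' \<longleftrightarrow> s = s'" if "s \<in> S" "s' \<in> S" for s s'
    using gf that by metis
  define M :: "'a tm" where
    "M = \<lparr>tapes = k, states = card S, work_symbols = b, start_state = f s0,
          accept_state = f yes, reject_state = f no,
          transition = (\<lambda>q cs. case \<delta> (g q) cs of (s', acts) \<Rightarrow> (f s', acts))\<rparr>"
  have alph: "alphabet M = {Blank} \<union> range Letter \<union> Work ` {..<b}"
    by (simp add: alphabet_def M_def)
  have "wf_tm M"
    unfolding wf_tm_def
  proof (intro conjI allI impI)
    fix q cs assume q: "q < states M" and cs: "length cs = tapes M \<and> set cs \<subseteq> alphabet M"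
    have "g q \<in> S" "length cs = k" using q cs by (auto simp: M_def intro: gS)
    hence "fst (\<delta> (g q) cs) \<in> S \<and> length (snd (\<delta> (g q) cs)) = k \<and>
        fst ` set (snd (\<delta> (g q) cs)) \<subseteq> alphabet M"
      using closed[of "g q" cs] cs unfolding alph by blast
    thus "case transition M q cs of (q', acts) \<Rightarrow>
        q' < states M \<and> length acts = tapes M \<and> fst ` set acts \<subseteq> alphabet M"
      by (cases "\<delta> (g q) cs") (simp add: M_def fS)
  qed (use k S fS finj in \<open>simp_all add: M_def\<close>)
  moreover have "decides_in_time M L (poly p)"
    unfolding decides_in_time_def
  proof
    fix w
    define c0 where "c0 = (s0, input_tape w # replicate (k - 1) (blank_tape :: 'a tape))"
    define good where "good c \<longleftrightarrow> fst c \<in> S \<and> length (snd c) = k \<and>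
      (\<forall>t\<in>set (snd c). range (fst t) \<subseteq> alphabet M)" for c :: "'s \<times> 'a tape list"
    define emb where "emb c = (f (fst c), snd c)" for c :: "'s \<times> 'a tape list"
    have good0: "good c0"
      using S k by (auto simp: good_def c0_def input_tape_def blank_tape_def alph)
    have good_step: "good (ctl_step \<delta> c)" if c: "good c" for c
    proof -
      obtain s ts where cs: "c = (s, ts)" by force
      obtain s' acts where d: "\<delta> s (map read_tape ts) = (s', acts)" by force
      have "set (map read_tape ts) \<subseteq> alphabet M"
        using c by (auto simp: good_def cs read_tape_def)
      hence cl: "s' \<in> S" "length acts = k" "fst ` set acts \<subseteq> alphabet M"
        using closed[of s "map read_tape ts"] c unfolding alph
        by (auto simp: good_def cs d)
      have act: "range (fst (act_tape a t)) \<subseteq> alphabet M"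
        if "a \<in> set acts" "t \<in> set ts" for a t
      proof -
        obtain x m h i where "a = (x, m)" "t = (h, i)" by (metis surj_pair)
        moreover have "fst a \<in> alphabet M" using that(1) cl(3) by auto
        moreover have "range (fst t) \<subseteq> alphabet M" using that(2) c by (simp add: good_def cs)
        ultimately show ?thesis by auto
      qed
      have "range (fst t') \<subseteq> alphabet M" if t': "t' \<in> set (map2 act_tape acts ts)" for t'
      proof -
        obtain a t where at: "(a, t) \<in> set (zip acts ts)" "t' = act_tape a t" using t' by auto
        show ?thesis
          using act[OF set_zip_leftD[OF at(1)] set_zip_rightD[OF at(1)]] by (simp add: at(2))
      qed
      thus ?thesis using cl c
        by (simp add: good_def cs ctl_step_eq d)
    qed
    have sim: "tm_step M (emb c) = emb (ctl_step \<delta> c) \<or>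
        (tm_step M (emb c) = emb c \<and> fst (ctl_step \<delta> c) = fst c \<and> (fst c = yes \<or> fst c = no))"
      if c: "good c" for c
    proof -
      obtain s ts where cs: "c = (s, ts)" by force
      show ?thesis
      proof (cases "s = yes \<or> s = no")
        case True
        thus ?thesis using halt[of s ts] by (auto simp: cs emb_def M_def)
      next
        case False
        thus ?thesis using c S finj
          by (auto simp: cs emb_def M_def ctl_step_eq gf good_def split: prod.splits)
      qed
    qed
    have halted: "fst ((ctl_step \<delta> ^^ t) c) = fst c" if "fst c = yes \<or> fst c = no" for t c
    proof (induction t)
      case (Suc t)
      thus ?case using halt[of "fst c" "snd ((ctl_step \<delta> ^^ t) c)"] that
        by (metis funpow.simps(2) o_apply prod.collapse)
    qed simp
    \<comment> \<open>Once halted, the machine freezes its tapes while \<open>\<delta>\<close> may still move them,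
       so from then on only the states are compared.\<close>
    have main: "good ((ctl_step \<delta> ^^ t) c0) \<and>
        fst ((tm_step M ^^ t) (emb c0)) = f (fst ((ctl_step \<delta> ^^ t) c0)) \<and>
        ((tm_step M ^^ t) (emb c0) = emb ((ctl_step \<delta> ^^ t) c0) \<or>
         fst ((ctl_step \<delta> ^^ t) c0) \<in> {yes, no})" for t
    proof (induction t)
      case 0
      thus ?case using good0 by (simp add: emb_def)
    next
      case (Suc t)
      let ?c = "(ctl_step \<delta> ^^ t) c0" and ?q = "(tm_step M ^^ t) (emb c0)"
      have g: "good ?c" using Suc by blast
      show ?case
      proof (cases "fst ?c \<in> {yes, no}")
        case True
        hence "fst (ctl_step \<delta> ?c) = fst ?c"
          using halt[of "fst ?c" "snd ?c"] by auto
        moreover have "tm_step M ?q = ?q"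
          using Suc True by (cases ?q) (auto simp: M_def)
        ultimately show ?thesis using Suc True good_step[OF g] by auto
      next
        case False
        hence "?q = emb ?c" using Suc by blast
        thus ?thesis using sim[OF g] False good_step[OF g] by (auto simp: emb_def)
      qed
    qed
    have init: "init_config M w = emb c0"
      by (simp add: init_config_def emb_def c0_def M_def)
    obtain t where t: "t \<le> poly p (length w)"
      "fst ((ctl_step \<delta> ^^ t) c0) = (if w \<in> L then yes else no)"
      using run[of w] unfolding c0_def by blast
    have acc: "accept_state M = f yes" "reject_state M = f no" by (simp_all add: M_def)
    show "\<exists>t\<le>poly p (length w). fst ((tm_step M ^^ t) (init_config M w)) =
        (if w \<in> L then accept_state M else reject_state M)"
      using t main[of t] by (intro exI[of _ t]) (simp add: init acc)
  qed
  ultimately show ?thesis unfolding in_P_def by blast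
qed

subsection \<open>Counter programs\<close>

text \<open>
  Programs whose only data are counters. Counter \<open>i\<close> is the position of the head on tape \<open>i\<close>, and
  all tapes carry the same text: a marker at position 0, the input at positions 1, 2, \<open>\<dots>\<close>, then
  blanks. So a counter can be tested for 0 by looking for the marker, and at the same time serves as
  a pointer into the input. A command \<open>Branch i A a b\<close> or \<open>While i A a\<close> tests whether the symbol
  under head \<open>i\<close> lies in \<open>A\<close>. The text is never changed.
\<close>

datatype 'a com =
    Skip
  | Inc nat
  | Dec nat
  | Seq "'a com" "'a com"  (infixr ";;" 60)
  | Branch nat "'a cell set" "'a com" "'a com"
  | While nat "'a cell set" "'a com"

definition sym_at :: "'a list \<Rightarrow> nat \<Rightarrow> 'a cell" where
  "sym_at w p = (if p = 0 then Work 0 else if p \<le> length w then Letter (w ! (p - 1)) else Blank)"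

text \<open>
  The number between the two states is the running time. Every test and every sequential
  composition costs one step, so that it is exactly the number of machine steps. \<open>Dec\<close> leaves 0 unchanged because the head does not pass the marker.
\<close>

inductive exec :: "'a list \<Rightarrow> 'a com \<Rightarrow> (nat \<Rightarrow> nat) \<Rightarrow> nat \<Rightarrow> (nat \<Rightarrow> nat) \<Rightarrow> bool" for w where
  Skip: "exec w Skip \<sigma> 1 \<sigma>"
| Inc: "exec w (Inc i) \<sigma> 1 (\<sigma>(i := Suc (\<sigma> i)))"
| Dec: "exec w (Dec i) \<sigma> 1 (\<sigma>(i := \<sigma> i - 1))"
| Seq: "exec w a \<sigma> t \<sigma>' \<Longrightarrow> exec w b \<sigma>' t' \<sigma>'' \<Longrightarrow> exec w (a ;; b) \<sigma> (Suc (t + t')) \<sigma>''"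
| Branch_True: "sym_at w (\<sigma> i) \<in> A \<Longrightarrow> exec w a \<sigma> t \<sigma>' \<Longrightarrow> exec w (Branch i A a b) \<sigma> (Suc t) \<sigma>'"
| Branch_False: "sym_at w (\<sigma> i) \<notin> A \<Longrightarrow> exec w b \<sigma> t \<sigma>' \<Longrightarrow> exec w (Branch i A a b) \<sigma> (Suc t) \<sigma>'"
| While_False: "sym_at w (\<sigma> i) \<notin> A \<Longrightarrow> exec w (While i A a) \<sigma> 1 \<sigma>"
| While_True: "sym_at w (\<sigma> i) \<in> A \<Longrightarrow> exec w a \<sigma> t \<sigma>' \<Longrightarrow> exec w (While i A a) \<sigma>' t' \<sigma>'' \<Longrightarrow>
     exec w (While i A a) \<sigma> (Suc (t + t')) \<sigma>''"

subsection \<open>Running a counter program on a machine\<close>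

text \<open>
  While the program runs, the control state is the list of commands still to be executed. This
  makes the transition function an abstract machine for \<open>exec\<close> that needs no jump labels. The states
  \<open>Copy\<close> and \<open>Rewind\<close> prepare the tapes: copy the input onto all of them, return to the left, and
  write the marker on the cell before the input.
\<close>

datatype 'a ctl = Copy | Rewind | Run "'a com list" | Halt bool

definition keep :: "'a cell list \<Rightarrow> ('a cell \<times> move) list" where
  "keep cs = map (\<lambda>c. (c, Stay)) cs"

fun run_step :: "'a com \<Rightarrow> ('a ctl, 'a) control" where
  "run_step c Copy cs =
     (if hd cs = Blank then (Rewind, map (\<lambda>x. (x, MoveLeft)) cs)
      else (Copy, map (\<lambda>x. (hd cs, MoveRight)) cs))"
| "run_step c Rewind cs =
     (if hd cs = Blank then (Run [c], map (\<lambda>x. (Work 0, Stay)) cs)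
      else (Rewind, map (\<lambda>x. (x, MoveLeft)) cs))"
| "run_step c (Halt b) cs = (Halt b, keep cs)"
| "run_step c (Run []) cs = (Halt (hd cs \<noteq> Work 0), keep cs)"
| "run_step c (Run (Skip # K)) cs = (Run K, keep cs)"
| "run_step c (Run (Inc i # K)) cs = (Run K, (keep cs)[i := (cs ! i, MoveRight)])"
| "run_step c (Run (Dec i # K)) cs =
     (Run K, (keep cs)[i := (cs ! i, if cs ! i = Work 0 then Stay else MoveLeft)])"
| "run_step c (Run ((a ;; b) # K)) cs = (Run (a # b # K), keep cs)"
| "run_step c (Run (Branch i A a b # K)) cs = (Run ((if cs ! i \<in> A then a else b) # K), keep cs)"
| "run_step c (Run (While i A a # K)) cs =
     (Run (if cs ! i \<in> A then a # While i A a # K else K), keep cs)"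

text \<open>
  The command lists that occur while \<open>c\<close> is executed in front of \<open>K\<close>. There are finitely many although
  loops unfold, since a loop body runs in front of the same loop and the same \<open>K\<close>.
\<close>

fun stacks :: "'a com \<Rightarrow> 'a com list \<Rightarrow> 'a com list set" where
  "stacks (a ;; b) K = insert ((a ;; b) # K) (stacks a (b # K) \<union> stacks b K)"
| "stacks (Branch i A a b) K = insert (Branch i A a b # K) (stacks a K \<union> stacks b K)"
| "stacks (While i A a) K = insert (While i A a # K) (stacks a (While i A a # K))"
| "stacks c K = {c # K}"

lemma finite_stacks: "finite (stacks c K)"
  by (induction c K rule: stacks.induct) auto

lemma Cons_in_stacks: "c # K \<in> stacks c K"
  by (cases c) auto

lemma stacks_closed:
  "q \<in> stacks c K \<Longrightarrow> \<exists>q'. fst (run_step c0 (Run q) cs) = Run q' \<and> q' \<in> insert K (stacks c K)"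
proof (induction c K arbitrary: q rule: stacks.induct)
  case (1 a b K)
  show ?case
  proof (cases "q = (a ;; b) # K")
    case True
    thus ?thesis using Cons_in_stacks[of a "b # K"] by auto
  next
    case False
    hence "q \<in> stacks a (b # K) \<or> q \<in> stacks b K" using "1.prems" by simp
    thus ?thesis using "1.IH" Cons_in_stacks[of b K] by (fastforce simp del: run_step.simps)
  qed
next
  case (2 i A a b K)
  show ?case
  proof (cases "q = Branch i A a b # K")
    case True
    thus ?thesis using Cons_in_stacks[of a K] Cons_in_stacks[of b K] by auto
  next
    case False
    hence "q \<in> stacks a K \<or> q \<in> stacks b K" using "2.prems" by simp
    thus ?thesis using "2.IH" by (fastforce simp del: run_step.simps)
  qed
next
  case (3 i A a K)
  show ?case
  proof (cases "q = While i A a # K")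
    case True
    thus ?thesis using Cons_in_stacks[of a "While i A a # K"] by auto
  next
    case False
    hence "q \<in> stacks a (While i A a # K)" using "3.prems" by simp
    thus ?thesis using "3.IH" by (fastforce simp del: run_step.simps)
  qed
qed auto

fun width :: "'a com \<Rightarrow> nat" where
  "width Skip = 0"
| "width (Inc i) = Suc i"
| "width (Dec i) = Suc i"
| "width (a ;; b) = max (width a) (width b)"
| "width (Branch i A a b) = max (Suc i) (max (width a) (width b))"
| "width (While i A a) = max (Suc i) (width a)"

text \<open>
  The input starts at cell 0 of its tape, so the marker sits at cell \<open>-1\<close>, and counter value \<open>p\<close> is
  the head position \<open>p - 1\<close>.
\<close>

definition counter_tape :: "'a list \<Rightarrow> nat \<Rightarrow> 'a tape" where
  "counter_tape w p = ((fst (input_tape w))(-1 := Work 0), int p - 1)"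

definition conf :: "nat \<Rightarrow> 'a list \<Rightarrow> (nat \<Rightarrow> nat) \<Rightarrow> 'a tape list" where
  "conf k w \<sigma> = map (\<lambda>i. counter_tape w (\<sigma> i)) [0..<k]"

lemma length_conf [simp]: "length (conf k w \<sigma>) = k"
  by (simp add: conf_def)

lemma nth_conf [simp]: "i < k \<Longrightarrow> conf k w \<sigma> ! i = counter_tape w (\<sigma> i)"
  by (simp add: conf_def)

lemma conf_update: "i < k \<Longrightarrow> (conf k w \<sigma>)[i := counter_tape w p] = conf k w (\<sigma>(i := p))"
  by (rule nth_equalityI) (auto simp: nth_list_update)

lemma read_counter_tape [simp]: "read_tape (counter_tape w p) = sym_at w p"
  by (auto simp: read_tape_def counter_tape_def sym_at_def input_tape_def nat_diff_distrib)

lemma sym_at_eq_mark_iff: "sym_at w p = Work 0 \<longleftrightarrow> p = 0"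
  by (simp add: sym_at_def)

lemma act_read: "act_tape (read_tape t, m) t = (fst t, move_head m (snd t))"
  by (cases t) (simp add: read_tape_def)

lemma map2_keep [simp]: "map2 act_tape (keep (map read_tape ts)) ts = ts"
  by (rule nth_equalityI) (auto simp: keep_def act_read)

lemma map2_keep_update:
  "i < length ts \<Longrightarrow> map2 act_tape ((keep (map read_tape ts))[i := (read_tape (ts ! i), m)]) ts =
     ts[i := (fst (ts ! i), move_head m (snd (ts ! i)))]"
  by (rule nth_equalityI) (auto simp: keep_def act_read nth_list_update)

lemma ctl_step_Inc:
  assumes "i < k"
  shows "ctl_step (run_step c) (Run (Inc i # K), conf k w \<sigma>) = (Run K, conf k w (\<sigma>(i := Suc (\<sigma> i))))"
proof -
  have "(fst (counter_tape w (\<sigma> i)), move_head MoveRight (snd (counter_tape w (\<sigma> i)))) =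
      counter_tape w (Suc (\<sigma> i))"
    by (simp add: counter_tape_def)
  thus ?thesis
    using map2_keep_update[of i "conf k w \<sigma>" MoveRight] assms
    by (simp add: ctl_step_eq conf_update del: read_counter_tape)
qed

lemma ctl_step_Dec:
  assumes "i < k"
  shows "ctl_step (run_step c) (Run (Dec i # K), conf k w \<sigma>) = (Run K, conf k w (\<sigma>(i := \<sigma> i - 1)))"
proof -
  define m where "m = (if sym_at w (\<sigma> i) = Work 0 then Stay else MoveLeft)"
  have "(fst (counter_tape w (\<sigma> i)), move_head m (snd (counter_tape w (\<sigma> i)))) =
      counter_tape w (\<sigma> i - 1)"
    by (auto simp: counter_tape_def m_def sym_at_eq_mark_iff)
  thus ?thesis
    using map2_keep_update[of i "conf k w \<sigma>" m] assms
    by (simp add: ctl_step_eq conf_update flip: m_def)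
qed

lemma ctl_run_exec:
  assumes "exec w a \<sigma> t \<sigma>'" "width a \<le> k"
  shows "(ctl_step (run_step c) ^^ t) (Run (a # K), conf k w \<sigma>) = (Run K, conf k w \<sigma>')"
  using assms
proof (induction arbitrary: K rule: exec.induct)
  case (Seq a \<sigma> t \<sigma>' b t' \<sigma>'')
  have "(ctl_step (run_step c) ^^ (t' + t)) (Run (a # b # K), conf k w \<sigma>) = (Run K, conf k w \<sigma>'')"
    using Seq by (simp add: funpow_add)
  moreover have "ctl_step (run_step c) (Run ((a ;; b) # K), conf k w \<sigma>) = (Run (a # b # K), conf k w \<sigma>)"
    by (simp add: ctl_step_eq)
  ultimately show ?case by (simp add: funpow_swap1 add.commute del: funpow.simps(2) add: funpow_Suc_right)
next
  case (While_True \<sigma> i A a t \<sigma>' t' \<sigma>'')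
  have "(ctl_step (run_step c) ^^ (t' + t)) (Run (a # While i A a # K), conf k w \<sigma>) = (Run K, conf k w \<sigma>'')"
    using While_True by (simp add: funpow_add)
  moreover have "ctl_step (run_step c) (Run (While i A a # K), conf k w \<sigma>) =
      (Run (a # While i A a # K), conf k w \<sigma>)"
    using While_True by (simp add: ctl_step_eq)
  ultimately show ?case by (simp add: add.commute funpow_Suc_right del: funpow.simps(2))
next
  case (Branch_True \<sigma> i A a t \<sigma>' b)
  have "ctl_step (run_step c) (Run (Branch i A a b # K), conf k w \<sigma>) = (Run (a # K), conf k w \<sigma>)"
    using Branch_True by (simp add: ctl_step_eq)
  thus ?case using Branch_True by (simp add: funpow_Suc_right del: funpow.simps(2))
next
  case (Branch_False \<sigma> i A b t \<sigma>' a)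
  have "ctl_step (run_step c) (Run (Branch i A a b # K), conf k w \<sigma>) = (Run (b # K), conf k w \<sigma>)"
    using Branch_False by (simp add: ctl_step_eq)
  thus ?case using Branch_False by (simp add: funpow_Suc_right del: funpow.simps(2))
next
  case (While_False \<sigma> i A a)
  thus ?case by (simp add: ctl_step_eq)
next
  case (Skip \<sigma>)
  show ?case by (simp add: ctl_step_eq)
next
  case (Inc i \<sigma>)
  thus ?case by (simp add: ctl_step_Inc del: fun_upd_apply)
next
  case (Dec i \<sigma>)
  thus ?case by (simp add: ctl_step_Dec del: fun_upd_apply)
qed

text \<open>
  Copying and rewinding take \<open>length w + 1\<close> steps each: the last step of the first pass meets the blank
  behind the input, that of the second the blank before it.
\<close>

lemma ctl_copy_input:
  assumes k: "k \<ge> 1"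
  shows "(ctl_step (run_step c) ^^ (2 * length w + 2)) (Copy, input_tape w # replicate (k - 1) blank_tape) =
     (Run [c], conf k w (\<lambda>_. 0))"
proof -
  let ?step = "ctl_step (run_step c)"
  obtain k' where k': "k = Suc k'" using k by (cases k) auto
  define inp where "inp = fst (input_tape w)"
  define part where "part j = (\<lambda>i. if 0 \<le> i \<and> i < int j then Letter (w ! nat i) else Blank :: 'a cell)" for j
  have part_Suc: "(part j)(int j := Letter (w ! j)) = part (Suc j)" for j
    by (auto simp: part_def fun_eq_iff)
  have copy: "(?step ^^ j) (Copy, input_tape w # replicate k' blank_tape) =
      (Copy, (inp, int j) # replicate k' (part j, int j))" if "j \<le> length w" for j
    using that
  proof (induction j)
    case 0
    show ?case by (simp add: inp_def part_def blank_tape_def fun_eq_iff) (simp add: input_tape_def)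
  next
    case (Suc j)
    have rd: "inp (int j) = Letter (w ! j)" using Suc.prems by (simp add: inp_def input_tape_def)
    have "inp(int j := Letter (w ! j)) = inp" using rd by (simp add: fun_upd_idem)
    thus ?case using Suc rd
      by (simp add: ctl_step_eq read_tape_def part_Suc map_replicate_const add.commute)
  qed
  have part_all: "part (length w) = inp" by (simp add: part_def inp_def input_tape_def)
  have inp_out: "inp (int (length w)) = Blank" "inp (-1) = Blank"
    by (simp_all add: inp_def input_tape_def)
  have "?step (Copy, replicate k (inp, int (length w))) = (Rewind, replicate k (inp, int (length w) - 1))"
    using inp_out(1) fun_upd_triv[of inp "int (length w)"]
    by (simp add: ctl_step_eq k' read_tape_def)
  hence 1: "(?step ^^ Suc (length w)) (Copy, input_tape w # replicate k' blank_tape) =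
      (Rewind, replicate k (inp, int (length w) - 1))"
    using copy[of "length w"] by (simp add: part_all k')
  have rew: "(?step ^^ j) (Rewind, replicate k (inp, int j - 1)) = (Rewind, replicate k (inp, -1))"
    if "j \<le> length w" for j
    using that
  proof (induction j)
    case (Suc j)
    have "inp (int j) \<noteq> Blank" using Suc.prems by (simp add: inp_def input_tape_def)
    hence "?step (Rewind, replicate k (inp, int (Suc j) - 1)) = (Rewind, replicate k (inp, int j - 1))"
      by (simp add: ctl_step_eq k' read_tape_def)
    thus ?case using Suc by (simp add: funpow_Suc_right del: funpow.simps(2) of_nat_Suc)
  qed simp
  have "?step (Rewind, replicate k (inp, -1)) = (Run [c], replicate k (inp(-1 := Work 0), -1))"
    using inp_out(2) by (simp add: ctl_step_eq k' read_tape_def map_replicate_const)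
  hence 2: "(?step ^^ Suc (length w)) (Rewind, replicate k (inp, int (length w) - 1)) =
      (Run [c], conf k w (\<lambda>_. 0))"
    using rew[of "length w"] by (simp add: conf_def counter_tape_def inp_def map_replicate_const)
  have "2 * length w + 2 = Suc (length w) + Suc (length w)" by simp
  thus ?thesis using 1 2 k' by (simp only: funpow_add o_apply diff_Suc_1)
qed

text \<open>
  Bounded by a polynomial rather than equal to one, so that time bounds can be assembled without
  exhibiting coefficients.
\<close>

definition poly_bounded :: "(nat \<Rightarrow> nat) \<Rightarrow> bool" where
  "poly_bounded f \<longleftrightarrow> (\<exists>p :: nat poly. \<forall>n. f n \<le> poly p n)"

lemma poly_bounded_const: "poly_bounded (\<lambda>n. a)"
  unfolding poly_bounded_def by (rule exI[of _ "[:a:]"]) simp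

lemma poly_bounded_id: "poly_bounded (\<lambda>n. n)"
  unfolding poly_bounded_def by (rule exI[of _ "[:0, 1:]"]) simp

lemma poly_bounded_add: "poly_bounded f \<Longrightarrow> poly_bounded g \<Longrightarrow> poly_bounded (\<lambda>n. f n + g n)"
  unfolding poly_bounded_def by (metis poly_add add_mono)

lemma poly_bounded_mult: "poly_bounded f \<Longrightarrow> poly_bounded g \<Longrightarrow> poly_bounded (\<lambda>n. f n * g n)"
  unfolding poly_bounded_def by (metis poly_mult mult_mono zero_le)

lemma poly_bounded_Suc: "poly_bounded f \<Longrightarrow> poly_bounded (\<lambda>n. Suc (f n))"
  using poly_bounded_add[of f, OF _ poly_bounded_const[of 1]] by simp

lemmas poly_bounded_intros =
  poly_bounded_const poly_bounded_id poly_bounded_add poly_bounded_mult poly_bounded_Suc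

text \<open>
  Counter 0 holds the answer. All tapes contain only the marker, letters and blanks, so one work
  symbol suffices, and the number of tapes is fixed by the program.
\<close>

theorem in_P_by_program:
  fixes L :: "'a::finite list set"
  assumes T: "poly_bounded T"
    and prog: "\<And>w. \<exists>t \<sigma>. exec w c (\<lambda>_. 0) t \<sigma> \<and> t \<le> T (length w) \<and> (\<sigma> 0 \<noteq> 0 \<longleftrightarrow> w \<in> L)"
  shows "in_P L"
proof -
  define k where "k = Suc (width c)"
  define S where "S = {Copy, Rewind, Halt True, Halt False} \<union> Run ` insert [] (stacks c [])"
  have "poly_bounded (\<lambda>n. Suc (T n + (2 * n + 2)))"
    by (intro poly_bounded_intros T)
  then obtain p :: "nat poly" where p: "\<And>n. Suc (T n + (2 * n + 2)) \<le> poly p n"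
    by (auto simp: poly_bounded_def)
  show ?thesis
  proof (rule in_P_by_control[of S k Copy "Halt True" "Halt False" 1 "run_step c" p])
    show "finite S" by (simp add: S_def finite_stacks)
    show "k \<ge> 1" by (simp add: k_def)
    show "Copy \<in> S" "Halt True \<in> S" "Halt False \<in> S" "Halt True \<noteq> Halt False"
      by (simp_all add: S_def)
  next
    fix s :: "'a ctl" and cs :: "'a cell list"
    let ?A = "{Blank} \<union> range Letter \<union> Work ` {..<1} :: 'a cell set"
    assume s: "s \<in> S" and cs: "length cs = k" "set cs \<subseteq> ?A"
    have hd: "hd cs \<in> ?A" using cs k_def by (cases cs) auto
    have "fst (run_step c s cs) \<in> S"
    proof (cases "\<exists>q \<in> stacks c []. s = Run q")
      case True
      then obtain q where "q \<in> stacks c []" "s = Run q" by blast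
      thus ?thesis using stacks_closed[of q c "[]" c cs] by (auto simp: S_def)
    next
      case False
      thus ?thesis using s Cons_in_stacks[of c "[]"]
        by (cases "hd cs = Blank") (auto simp: S_def)
    qed
    moreover have "length (snd (run_step c s cs)) = k \<and> fst ` set (snd (run_step c s cs)) \<subseteq> ?A"
    proof -
      have upd: "fst ` set ((keep cs)[i := (cs ! i, m)]) \<subseteq> ?A" for i m
      proof (cases "i < length cs")
        case True
        hence 1: "cs ! i \<in> ?A" using cs(2) nth_mem by (metis subsetD)
        have 2: "fst ` set (keep cs) \<subseteq> ?A" using cs(2) by (simp add: keep_def image_image)
        have "fst ` set ((keep cs)[i := (cs ! i, m)]) \<subseteq> fst ` insert (cs ! i, m) (set (keep cs))"
          by (intro image_mono set_update_subset_insert)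
        also have "\<dots> \<subseteq> ?A" using 1 2 by (simp only: image_insert fst_conv insert_subset)
        finally show ?thesis .
      next
        case False
        thus ?thesis using cs(2) by (simp add: keep_def list_update_beyond image_image)
      qed
      have kp: "fst ` set (keep cs) \<subseteq> ?A" using cs(2) by (simp add: keep_def image_image)
      have len: "length (keep cs) = k" using cs(1) by (simp add: keep_def)
      have const: "fst ` set (map (\<lambda>x. (y, m)) cs) \<subseteq> ?A" if "y \<in> ?A" for y and m :: move
        using that by auto
      have same: "fst ` set (map (\<lambda>x. (x, m)) cs) \<subseteq> ?A" for m :: move
        using cs(2) by (simp add: image_image)
      have W: "Work 0 \<in> ?A" by simp
      show ?thesis
        using cs(1) upd kp len const[OF hd] const[OF W] same
        by (cases "(c, s, cs)" rule: run_step.cases) (simp_all split: if_splits)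
    qed
    ultimately show "fst (run_step c s cs) \<in> S \<and> length (snd (run_step c s cs)) = k \<and>
        fst ` set (snd (run_step c s cs)) \<subseteq> ?A" by blast
  next
    fix s :: "'a ctl" and ts
    assume "s = Halt True \<or> s = Halt False"
    thus "fst (ctl_step (run_step c) (s, ts)) = s" by (auto simp: ctl_step_eq)
  next
    fix w
    obtain t \<sigma> where t: "exec w c (\<lambda>_. 0) t \<sigma>" "t \<le> T (length w)" "\<sigma> 0 \<noteq> 0 \<longleftrightarrow> w \<in> L"
      using prog by blast
    have "conf k w \<sigma> \<noteq> []" by (simp add: conf_def k_def)
    hence "hd (map read_tape (conf k w \<sigma>)) = sym_at w (\<sigma> 0)"
      by (simp add: hd_map hd_conv_nth k_def)
    hence "fst (ctl_step (run_step c) (Run [], conf k w \<sigma>)) = Halt (w \<in> L)"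
      using t(3) by (simp add: ctl_step_eq sym_at_eq_mark_iff)
    moreover have "(ctl_step (run_step c) ^^ (2 * length w + 2))
        (Copy, input_tape w # replicate (k - 1) blank_tape) = (Run [c], conf k w (\<lambda>_. 0))"
      by (rule ctl_copy_input) (simp add: k_def)
    hence "(ctl_step (run_step c) ^^ (t + (2 * length w + 2)))
        (Copy, input_tape w # replicate (k - 1) blank_tape) = (Run [], conf k w \<sigma>)"
      using ctl_run_exec[OF t(1), of k c "[]"] by (subst funpow_add) (simp add: k_def)
    ultimately have "fst ((ctl_step (run_step c) ^^ Suc (t + (2 * length w + 2)))
        (Copy, input_tape w # replicate (k - 1) blank_tape)) = (if w \<in> L then Halt True else Halt False)"
      by simp
    moreover have "Suc (t + (2 * length w + 2)) \<le> poly p (length w)"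
      using t(2) p[of "length w"] by linarith
    ultimately show "\<exists>t\<le>poly p (length w). fst ((ctl_step (run_step c) ^^ t)
        (Copy, input_tape w # replicate (k - 1) blank_tape)) = (if w \<in> L then Halt True else Halt False)"
      by blast
  qed
qed

section \<open>Deciding first-order properties of words\<close>

subsection \<open>Programs with a time bound\<close>

definition runs :: "'a list \<Rightarrow> 'a com \<Rightarrow> (nat \<Rightarrow> nat) \<Rightarrow> (nat \<Rightarrow> nat) \<Rightarrow> nat \<Rightarrow> bool" where
  "runs w c \<sigma> \<sigma>' B \<longleftrightarrow> (\<exists>t \<le> B. exec w c \<sigma> t \<sigma>')"

abbreviation nonzero :: "'a cell set" where
  "nonzero \<equiv> - {Work 0}"

lemma sym_at_Blank: "sym_at w p = Blank \<longleftrightarrow> length w < p"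
  by (simp add: sym_at_def)

lemma runs_Skip: "runs w Skip \<sigma> \<sigma> 1"
  unfolding runs_def using exec.Skip by blast

lemma runs_Inc: "runs w (Inc i) \<sigma> (\<sigma>(i := Suc (\<sigma> i))) 1"
  unfolding runs_def using exec.Inc by blast

lemma runs_Dec: "runs w (Dec i) \<sigma> (\<sigma>(i := \<sigma> i - 1)) 1"
  unfolding runs_def using exec.Dec by blast

lemma runs_weaken: "runs w c \<sigma> \<sigma>' B \<Longrightarrow> \<sigma>' = \<sigma>'' \<Longrightarrow> B \<le> B' \<Longrightarrow> runs w c \<sigma> \<sigma>'' B'"
  unfolding runs_def using le_trans by blast

lemma runs_Seq: "runs w a \<sigma> \<sigma>' B \<Longrightarrow> runs w b \<sigma>' \<sigma>'' B' \<Longrightarrow> runs w (a ;; b) \<sigma> \<sigma>'' (Suc (B + B'))"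
  unfolding runs_def by (meson exec.Seq Suc_le_mono add_mono)

lemma runs_Branch:
  assumes "sym_at w (\<sigma> i) \<in> A \<Longrightarrow> runs w a \<sigma> \<sigma>' B" "sym_at w (\<sigma> i) \<notin> A \<Longrightarrow> runs w b \<sigma> \<sigma>' B"
  shows "runs w (Branch i A a b) \<sigma> \<sigma>' (Suc B)"
  using assms unfolding runs_def by (meson exec.Branch_True exec.Branch_False Suc_le_mono)

lemma runs_While_False: "sym_at w (\<sigma> i) \<notin> A \<Longrightarrow> runs w (While i A a) \<sigma> \<sigma> 1"
  unfolding runs_def using exec.While_False by blast

lemma runs_While_True:
  "sym_at w (\<sigma> i) \<in> A \<Longrightarrow> runs w a \<sigma> \<sigma>' B \<Longrightarrow> runs w (While i A a) \<sigma>' \<sigma>'' B' \<Longrightarrow>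
   runs w (While i A a) \<sigma> \<sigma>'' (Suc (B + B'))"
  unfolding runs_def by (meson exec.While_True Suc_le_mono add_mono)

text \<open>
  All loops except the search for a witness have this shape: \<open>st j\<close> is the state in which the loop
  counter has the value \<open>j\<close>.
\<close>

lemma runs_countdown:
  assumes "\<And>j. j < m \<Longrightarrow> runs w a (st (Suc j)) (st j) B" and "\<And>j. j \<le> m \<Longrightarrow> st j i = j"
  shows "runs w (While i nonzero a) (st m) (st 0) (m * Suc B + 1)"
  using assms
proof (induction m)
  case 0
  thus ?case using runs_While_False[of w "st 0" i nonzero a] by (simp add: sym_at_eq_mark_iff)
next
  case (Suc m)
  have "runs w (While i nonzero a) (st m) (st 0) (m * Suc B + 1)"
    using Suc by simp
  moreover have "sym_at w (st (Suc m) i) \<in> nonzero"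
    using Suc.prems(2)[of "Suc m"] by (simp add: sym_at_eq_mark_iff)
  ultimately have "runs w (While i nonzero a) (st (Suc m)) (st 0) (Suc (B + (m * Suc B + 1)))"
    using Suc.prems(1)[of m] by (intro runs_While_True[where \<sigma>' = "st m"]) auto
  thus ?case by (rule runs_weaken) auto
qed

lemma runs_clear: "runs w (While i nonzero (Dec i)) \<sigma> (\<sigma>(i := 0)) (\<sigma> i * 2 + 1)"
proof -
  have "runs w (While i nonzero (Dec i)) (\<sigma>(i := \<sigma> i)) (\<sigma>(i := 0)) (\<sigma> i * Suc 1 + 1)"
  proof (rule runs_countdown)
    fix j
    show "runs w (Dec i) (\<sigma>(i := Suc j)) (\<sigma>(i := j)) 1"
      by (rule runs_weaken[OF runs_Dec]) auto
  qed simp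
  thus ?thesis by (simp add: numeral_2_eq_2)
qed

subsection \<open>Terms\<close>

datatype trm = Var nat | Succ trm | Add trm trm | Mul trm trm

fun tval :: "(nat \<Rightarrow> nat) \<Rightarrow> trm \<Rightarrow> nat" where
  "tval \<sigma> (Var x) = \<sigma> x"
| "tval \<sigma> (Succ e) = Suc (tval \<sigma> e)"
| "tval \<sigma> (Add e f) = tval \<sigma> e + tval \<sigma> f"
| "tval \<sigma> (Mul e f) = tval \<sigma> e * tval \<sigma> f"

fun tvars :: "trm \<Rightarrow> nat set" where
  "tvars (Var x) = {x}"
| "tvars (Succ e) = tvars e"
| "tvars (Add e f) = tvars e \<union> tvars f"
| "tvars (Mul e f) = tvars e \<union> tvars f"

lemma tval_cong: "(\<And>x. x \<in> tvars e \<Longrightarrow> \<sigma> x = \<tau> x) \<Longrightarrow> tval \<sigma> e = tval \<tau> e"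
  by (induction e) auto

lemma tval_mono: "(\<And>x. x \<in> tvars e \<Longrightarrow> \<sigma> x \<le> \<tau> x) \<Longrightarrow> tval \<sigma> e \<le> tval \<tau> e"
  by (induction e) (auto intro: add_mono mult_mono)

lemma poly_bounded_tval: "poly_bounded (\<lambda>n. tval (\<lambda>_. n) e)"
  by (induction e) (simp_all add: poly_bounded_intros)

text \<open>
  Adds the value of a term to counter \<open>c\<close>, using the counters from \<open>s\<close> on as scratch space. Scratch
  counters are 0 before and after, here and below, so that programs compose without side effects.
  Reading a variable destroys it, hence the copy in \<open>s\<close> from which it is restored; a product is
  repeated addition, controlled by the value of the first factor in \<open>s\<close>.
\<close>

fun add_to :: "trm \<Rightarrow> nat \<Rightarrow> nat \<Rightarrow> 'a com" where
  "add_to (Var x) c s =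
     While x nonzero (Dec x ;; Inc s ;; Inc c) ;; While s nonzero (Dec s ;; Inc x)"
| "add_to (Succ e) c s = add_to e c s ;; Inc c"
| "add_to (Add e f) c s = add_to e c s ;; add_to f c s"
| "add_to (Mul e f) c s = add_to e s (Suc s) ;; While s nonzero (Dec s ;; add_to f c (Suc s))"

fun tcost :: "trm \<Rightarrow> nat \<Rightarrow> nat" where
  "tcost (Var x) n = 10 * n + 3"
| "tcost (Succ e) n = tcost e n + 2"
| "tcost (Add e f) n = Suc (tcost e n + tcost f n)"
| "tcost (Mul e f) n = tcost e n + tval (\<lambda>_. n) e * (tcost f n + 3) + 2"

lemma poly_bounded_tcost: "poly_bounded (tcost e)"
proof -
  have "poly_bounded (\<lambda>n. tcost e n)"
    by (induction e) (simp_all only: tcost.simps poly_bounded_intros poly_bounded_tval)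
  thus ?thesis by simp
qed

lemma runs_add_to:
  assumes "\<And>x. x \<in> tvars e \<Longrightarrow> x < c \<and> \<sigma> x \<le> n" "c < s" "\<And>i. s \<le> i \<Longrightarrow> \<sigma> i = 0"
  shows "runs w (add_to e c s) \<sigma> (\<sigma>(c := \<sigma> c + tval \<sigma> e)) (tcost e n)"
  using assms
proof (induction e arbitrary: c s \<sigma>)
  case (Var x)
  have x: "x < c" "\<sigma> x \<le> n" and s: "\<sigma> s = 0" using Var by auto
  \<comment> \<open>\<open>st j\<close>: the first loop with \<open>j\<close> units left in \<open>x\<close>;
       \<open>st' j\<close>: the second loop with \<open>j\<close> units left in \<open>s\<close>\<close>
  define st where "st j = \<sigma>(x := j, s := \<sigma> x - j, c := \<sigma> c + (\<sigma> x - j))" for j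
  define st' where "st' j = \<sigma>(x := \<sigma> x - j, s := j, c := \<sigma> c + \<sigma> x)" for j
  have 1: "runs w (While x nonzero (Dec x ;; Inc s ;; Inc c)) (st (\<sigma> x)) (st 0) (\<sigma> x * Suc 5 + 1)"
  proof (rule runs_countdown)
    fix j assume j: "j < \<sigma> x"
    show "runs w (Dec x ;; Inc s ;; Inc c) (st (Suc j)) (st j) 5"
      by (rule runs_weaken, (rule runs_Seq runs_Dec runs_Inc)+)
         (use j x Var.prems(2) in \<open>auto simp: st_def fun_eq_iff\<close>)
  qed (use x Var.prems(2) in \<open>auto simp: st_def\<close>)
  have 2: "runs w (While s nonzero (Dec s ;; Inc x)) (st' (\<sigma> x)) (st' 0) (\<sigma> x * Suc 3 + 1)"
  proof (rule runs_countdown)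
    fix j assume j: "j < \<sigma> x"
    show "runs w (Dec s ;; Inc x) (st' (Suc j)) (st' j) 3"
      by (rule runs_weaken, (rule runs_Seq runs_Dec runs_Inc)+)
         (use j x Var.prems(2) in \<open>auto simp: st'_def fun_eq_iff\<close>)
  qed (use x Var.prems(2) in \<open>auto simp: st'_def\<close>)
  have eqs: "st (\<sigma> x) = \<sigma>" "st' (\<sigma> x) = st 0" "st' 0 = \<sigma>(c := \<sigma> c + \<sigma> x)"
    using x s Var.prems(2) by (auto simp: st_def st'_def fun_eq_iff)
  show ?case
    using runs_Seq[OF 1 2[unfolded eqs(2)]] x(2)
    by (simp add: eqs) (erule runs_weaken, auto)
next
  case (Succ e)
  have 1: "runs w (add_to e c s) \<sigma> (\<sigma>(c := \<sigma> c + tval \<sigma> e)) (tcost e n)"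
    using Succ.prems by (intro Succ.IH) auto
  show ?case
    unfolding add_to.simps by (rule runs_weaken[OF runs_Seq[OF 1 runs_Inc]]) auto
next
  case (Add e f)
  define \<sigma>' where "\<sigma>' = \<sigma>(c := \<sigma> c + tval \<sigma> e)"
  have 1: "runs w (add_to e c s) \<sigma> \<sigma>' (tcost e n)"
    unfolding \<sigma>'_def using Add.prems by (intro Add.IH(1)) auto
  have "tval \<sigma>' f = tval \<sigma> f"
    using Add.prems(1) by (intro tval_cong) (auto simp: \<sigma>'_def)
  moreover have "runs w (add_to f c s) \<sigma>' (\<sigma>'(c := \<sigma>' c + tval \<sigma>' f)) (tcost f n)"
    using Add.prems by (intro Add.IH(2)) (auto simp: \<sigma>'_def)
  ultimately have "runs w (add_to f c s) \<sigma>' (\<sigma>(c := \<sigma> c + (tval \<sigma> e + tval \<sigma> f))) (tcost f n)"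
    by (simp add: \<sigma>'_def add.assoc)
  from runs_Seq[OF 1 this] show ?case
    unfolding add_to.simps by (rule runs_weaken) auto
next
  case (Mul e f)
  define E F where "E = tval \<sigma> e" and "F = tval \<sigma> f"
  have s: "\<sigma> s = 0" using Mul.prems by simp
  have "runs w (add_to e s (Suc s)) \<sigma> (\<sigma>(s := \<sigma> s + tval \<sigma> e)) (tcost e n)"
    using Mul.prems by (intro Mul.IH(1)) (auto dest: less_trans)
  hence 1: "runs w (add_to e s (Suc s)) \<sigma> (\<sigma>(s := E)) (tcost e n)"
    by (simp add: s E_def)
  \<comment> \<open>\<open>j\<close> copies of the second factor are still to be added\<close>
  define st where "st j = \<sigma>(s := j, c := \<sigma> c + (E - j) * F)" for j
  have 2: "runs w (While s nonzero (Dec s ;; add_to f c (Suc s))) (st E) (st 0) (E * Suc (tcost f n + 2) + 1)"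
  proof (rule runs_countdown)
    fix j assume j: "j < E"
    define \<tau> where "\<tau> = (st (Suc j))(s := j)"
    have "runs w (Dec s) (st (Suc j)) \<tau> 1"
      by (rule runs_weaken[OF runs_Dec]) (use Mul.prems(2) in \<open>auto simp: \<tau>_def st_def\<close>)
    moreover have vars: "x < c \<and> \<tau> x = \<sigma> x \<and> \<sigma> x \<le> n" if "x \<in> tvars f" for x
    proof -
      have "x < c" "\<sigma> x \<le> n" using Mul.prems(1) that by auto
      thus ?thesis using Mul.prems(2) by (simp add: \<tau>_def st_def)
    qed
    hence "runs w (add_to f c (Suc s)) \<tau> (\<tau>(c := \<tau> c + tval \<tau> f)) (tcost f n)"
      by (intro Mul.IH(2)) (use Mul.prems(2,3) in \<open>auto simp: \<tau>_def st_def\<close>)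
    moreover have "tval \<tau> f = F"
      unfolding F_def using vars by (intro tval_cong) auto
    moreover have "(E - Suc j) * F + F = (E - j) * F"
      using j by (metis Suc_diff_Suc add.commute mult_Suc)
    hence "\<tau>(c := \<tau> c + F) = st j"
      using Mul.prems(2) by (auto simp: \<tau>_def st_def fun_eq_iff)
    ultimately have "runs w (Dec s ;; add_to f c (Suc s)) (st (Suc j)) (st j) (Suc (1 + tcost f n))"
      by (intro runs_Seq[of _ _ _ \<tau>]) simp_all
    thus "runs w (Dec s ;; add_to f c (Suc s)) (st (Suc j)) (st j) (tcost f n + 2)" by simp
  qed (use Mul.prems(2) in \<open>auto simp: st_def\<close>)
  have eqs: "st E = \<sigma>(s := E)" "st 0 = \<sigma>(c := \<sigma> c + E * F)"
    using s Mul.prems(2) by (auto simp: st_def fun_eq_iff)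
  have E: "E \<le> tval (\<lambda>_. n) e"
    unfolding E_def using Mul.prems(1) by (intro tval_mono) auto
  have "E * (tcost f n + 3) \<le> tval (\<lambda>_. n) e * (tcost f n + 3)"
    using E by (rule mult_le_mono1)
  hence bound: "Suc (tcost e n + (E * Suc (tcost f n + 2) + 1)) \<le> tcost (Mul e f) n"
    by (simp add: algebra_simps)
  show ?case
    using runs_Seq[OF 1 2[unfolded eqs]] unfolding add_to.simps tval.simps E_def[symmetric] F_def[symmetric]
    by (rule runs_weaken[OF _ refl bound])
qed

subsection \<open>Formulas\<close>

text \<open>
  \<open>Read e A\<close> says that the symbol at the position given by \<open>e\<close> belongs to \<open>A\<close>. A term may exceed the
  length of the word, in which case the symbol is the blank.
\<close>

datatype 'a fm =
    Read trm "'a cell set"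
  | Le trm trm
  | Neg "'a fm"
  | Conj "'a fm" "'a fm"
  | Exists nat "'a fm"

fun sat :: "'a list \<Rightarrow> (nat \<Rightarrow> nat) \<Rightarrow> 'a fm \<Rightarrow> bool" where
  "sat w \<sigma> (Read e A) \<longleftrightarrow> sym_at w (tval \<sigma> e) \<in> A"
| "sat w \<sigma> (Le e f) \<longleftrightarrow> tval \<sigma> e \<le> tval \<sigma> f"
| "sat w \<sigma> (Neg \<phi>) \<longleftrightarrow> \<not> sat w \<sigma> \<phi>"
| "sat w \<sigma> (Conj \<phi> \<psi>) \<longleftrightarrow> sat w \<sigma> \<phi> \<and> sat w \<sigma> \<psi>"
| "sat w \<sigma> (Exists x \<phi>) \<longleftrightarrow> (\<exists>v \<le> length w. sat w (\<sigma>(x := v)) \<phi>)"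

text \<open>
  Bound variables are numbered by nesting depth, starting from 1. Inside \<open>d - 1\<close> quantifiers the
  variables are then the counters \<open>1, \<dots>, d - 1\<close>, and those from \<open>d\<close> on are free for scratch use.
\<close>

fun levelled :: "nat \<Rightarrow> 'a fm \<Rightarrow> bool" where
  "levelled d (Read e A) \<longleftrightarrow> tvars e \<subseteq> {1..<d}"
| "levelled d (Le e f) \<longleftrightarrow> tvars e \<union> tvars f \<subseteq> {1..<d}"
| "levelled d (Neg \<phi>) \<longleftrightarrow> levelled d \<phi>"
| "levelled d (Conj \<phi> \<psi>) \<longleftrightarrow> levelled d \<phi> \<and> levelled d \<psi>"
| "levelled d (Exists x \<phi>) \<longleftrightarrow> x = d \<and> levelled (Suc d) \<phi>"

text \<open>
  Stores the truth value of a formula in counter 0 and changes nothing else. A quantifier tries the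
  values of counter \<open>d\<close> in turn until counter 0 becomes nonzero. Passing the end of the word also
  sets counter 0, in order to stop the loop; the blank under head \<open>d\<close> then tells this case from
  success.
\<close>

fun checker :: "nat \<Rightarrow> 'a fm \<Rightarrow> 'a com" where
  "checker d (Read e A) = add_to e d (Suc d) ;; Branch d A (Inc 0) Skip ;; While d nonzero (Dec d)"
| "checker d (Le e f) =
     add_to e d (d + 2) ;; add_to f (Suc d) (d + 2) ;;
     While (Suc d) nonzero (Dec (Suc d) ;; Dec d) ;;
     Branch d nonzero (While d nonzero (Dec d)) (Inc 0)"
| "checker d (Neg \<phi>) = checker d \<phi> ;; Branch 0 nonzero (Dec 0) (Inc 0)"
| "checker d (Conj \<phi> \<psi>) = checker d \<phi> ;; Branch 0 nonzero (Dec 0 ;; checker d \<psi>) Skip"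
| "checker d (Exists x \<phi>) =
     While 0 {Work 0}
       (checker (Suc d) \<phi> ;;
        Branch 0 {Work 0} (Inc d ;; Branch d {Blank} (Inc 0) Skip) Skip) ;;
     Branch d {Blank} (Dec 0) Skip ;;
     While d nonzero (Dec d)"

text \<open>
  Upper bounds for the running time; \<open>tval (\<lambda>_. n) e\<close> bounds the value of a term, because terms
  are monotone and all variables are at most \<open>n\<close>.
\<close>

fun cost :: "'a fm \<Rightarrow> nat \<Rightarrow> nat" where
  "cost (Read e A) n = tcost e n + 2 * tval (\<lambda>_. n) e + 5"
| "cost (Le e f) n =
     tcost e n + tcost f n + 4 * tval (\<lambda>_. n) f + 2 * tval (\<lambda>_. n) e + 6"
| "cost (Neg \<phi>) n = cost \<phi> n + 3"
| "cost (Conj \<phi> \<psi>) n = cost \<phi> n + cost \<psi> n + 4"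
| "cost (Exists x \<phi>) n = (n + 1) * (cost \<phi> n + 7) + 2 * n + 8"

lemma poly_bounded_cost: "poly_bounded (cost \<phi>)"
proof -
  have "poly_bounded (\<lambda>n. cost \<phi> n)"
    by (induction \<phi>)
       (simp_all only: cost.simps poly_bounded_intros poly_bounded_tcost poly_bounded_tval)
  thus ?thesis by simp
qed

text \<open>
  The loop for a quantifier, started at the value \<open>v\<close>; stopping at \<open>Suc (length w)\<close> means
  that no witness was found from \<open>v\<close> on.
\<close>

lemma runs_search:
  assumes body: "\<And>v. v \<le> length w \<Longrightarrow>
      runs w a (\<sigma>(d := v)) ((\<sigma>(d := v))(0 := of_bool (Q v))) C"
    and d: "d \<ge> 1" and \<sigma>0: "\<sigma> 0 = 0" and v: "v \<le> length w"
  shows "\<exists>v' \<le> Suc (length w). (v' = Suc (length w) \<longleftrightarrow> \<not> (\<exists>u. v \<le> u \<and> u \<le> length w \<and> Q u)) \<and>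
     runs w (While 0 {Work 0} (a ;; Branch 0 {Work 0} (Inc d ;; Branch d {Blank} (Inc 0) Skip) Skip))
       (\<sigma>(d := v)) (\<sigma>(d := v', 0 := 1)) ((Suc (length w) - v) * (C + 7) + 1)"
    (is "\<exists>v' \<le> _. _ \<and> runs w ?loop _ _ _")
  using v
proof (induction "length w - v" arbitrary: v rule: less_induct)
  case less
  let ?N = "length w"
  let ?step = "Branch 0 {Work 0} (Inc d ;; Branch d {Blank} (Inc 0) Skip) Skip"
  have d0: "d \<noteq> 0" using d by simp
  note body = body[OF less.prems]
  have stop: "runs w ?loop (\<sigma>(d := v', 0 := 1)) (\<sigma>(d := v', 0 := 1)) 1" for v'
    by (rule runs_While_False) (simp add: sym_at_eq_mark_iff)
  have go: "sym_at w ((\<sigma>(d := v)) 0) \<in> {Work 0}"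
    using d0 \<sigma>0 by (simp add: sym_at_eq_mark_iff)
  obtain k where k: "Suc ?N - v = Suc k" "?N - v = k" using less.prems by (simp add: Suc_diff_le)
  show ?case
  proof (cases "Q v")
    case True
    have "runs w ?step (\<sigma>(d := v, 0 := 1)) (\<sigma>(d := v, 0 := 1)) (Suc 4)"
      by (rule runs_Branch) (auto simp: sym_at_eq_mark_iff intro: runs_weaken[OF runs_Skip])
    hence "runs w (a ;; ?step) (\<sigma>(d := v)) (\<sigma>(d := v, 0 := 1)) (Suc (C + Suc 4))"
      using True body by (intro runs_Seq) simp_all
    hence "runs w ?loop (\<sigma>(d := v)) (\<sigma>(d := v, 0 := 1)) (Suc (Suc (C + Suc 4) + 1))"
      using go stop by (intro runs_While_True)
    hence "runs w ?loop (\<sigma>(d := v)) (\<sigma>(d := v, 0 := 1)) ((Suc ?N - v) * (C + 7) + 1)"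
      by (rule runs_weaken) (simp_all add: k)
    thus ?thesis using True less.prems by (intro exI[of _ v]) auto
  next
    case False
    have \<sigma>: "(\<sigma>(d := v))(0 := of_bool (Q v)) = \<sigma>(d := v)"
      using False \<sigma>0 d0 by (auto simp: fun_eq_iff)
    have inc: "runs w (Inc d) (\<sigma>(d := v)) (\<sigma>(d := Suc v)) 1"
      by (rule runs_weaken[OF runs_Inc]) auto
    show ?thesis
    proof (cases "v = ?N")
      case True
      have "runs w (Branch d {Blank} (Inc 0) Skip) (\<sigma>(d := Suc v)) (\<sigma>(d := Suc v, 0 := 1)) (Suc 1)"
      proof (rule runs_Branch)
        show "runs w (Inc 0) (\<sigma>(d := Suc v)) (\<sigma>(d := Suc v, 0 := 1)) 1"
          by (rule runs_weaken[OF runs_Inc]) (use d0 \<sigma>0 in auto)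
      qed (use True in \<open>auto simp: sym_at_Blank\<close>)
      hence "runs w (Inc d ;; Branch d {Blank} (Inc 0) Skip) (\<sigma>(d := v)) (\<sigma>(d := Suc v, 0 := 1)) (Suc (1 + Suc 1))"
        by (rule runs_Seq[OF inc])
      hence "runs w ?step (\<sigma>(d := v)) (\<sigma>(d := Suc v, 0 := 1)) (Suc (Suc (1 + Suc 1)))"
        using go by (intro runs_Branch) auto
      hence "runs w (a ;; ?step) (\<sigma>(d := v)) (\<sigma>(d := Suc v, 0 := 1)) (Suc (C + Suc (Suc (1 + Suc 1))))"
        using body unfolding \<sigma> by (intro runs_Seq)
      hence "runs w ?loop (\<sigma>(d := v)) (\<sigma>(d := Suc v, 0 := 1)) (Suc (Suc (C + Suc (Suc (1 + Suc 1))) + 1))"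
        using go stop by (intro runs_While_True)
      hence "runs w ?loop (\<sigma>(d := v)) (\<sigma>(d := Suc v, 0 := 1)) ((Suc ?N - v) * (C + 7) + 1)"
        by (rule runs_weaken) (simp_all add: k)
      thus ?thesis using True False by (intro exI[of _ "Suc v"]) auto
    next
      case notend: False
      have "runs w (Branch d {Blank} (Inc 0) Skip) (\<sigma>(d := Suc v)) (\<sigma>(d := Suc v)) (Suc 1)"
        by (rule runs_Branch) (use notend less.prems in \<open>auto simp: sym_at_Blank intro: runs_weaken[OF runs_Skip]\<close>)
      hence "runs w (Inc d ;; Branch d {Blank} (Inc 0) Skip) (\<sigma>(d := v)) (\<sigma>(d := Suc v)) (Suc (1 + Suc 1))"
        by (rule runs_Seq[OF inc])
      hence "runs w ?step (\<sigma>(d := v)) (\<sigma>(d := Suc v)) (Suc (Suc (1 + Suc 1)))"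
        using go by (intro runs_Branch) auto
      hence iter: "runs w (a ;; ?step) (\<sigma>(d := v)) (\<sigma>(d := Suc v)) (Suc (C + Suc (Suc (1 + Suc 1))))"
        using body unfolding \<sigma> by (intro runs_Seq)
      have "?N - Suc v < ?N - v" "Suc v \<le> ?N" using notend less.prems by auto
      then obtain v' where v': "v' \<le> Suc ?N"
        "v' = Suc ?N \<longleftrightarrow> \<not> (\<exists>u. Suc v \<le> u \<and> u \<le> ?N \<and> Q u)"
        "runs w ?loop (\<sigma>(d := Suc v)) (\<sigma>(d := v', 0 := 1)) ((Suc ?N - Suc v) * (C + 7) + 1)"
        using less.hyps by blast
      have "runs w ?loop (\<sigma>(d := v)) (\<sigma>(d := v', 0 := 1))
          (Suc (Suc (C + Suc (Suc (1 + Suc 1))) + ((Suc ?N - Suc v) * (C + 7) + 1)))"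
        using go iter v'(3) by (intro runs_While_True)
      hence "runs w ?loop (\<sigma>(d := v)) (\<sigma>(d := v', 0 := 1)) ((Suc ?N - v) * (C + 7) + 1)"
        by (rule runs_weaken) (simp_all add: k)
      moreover have "(\<exists>u. Suc v \<le> u \<and> u \<le> ?N \<and> Q u) \<longleftrightarrow> (\<exists>u. v \<le> u \<and> u \<le> ?N \<and> Q u)"
        using False by (metis Suc_leD Suc_leI le_neq_implies_less)
      ultimately show ?thesis using v'(1,2) by (intro exI[of _ v']) simp
    qed
  qed
qed

lemma runs_checker:
  assumes "levelled d \<phi>" "d \<ge> 1" "\<sigma> 0 = 0" "\<And>i. d \<le> i \<Longrightarrow> \<sigma> i = 0" "\<And>i. \<sigma> i \<le> length w"
  shows "runs w (checker d \<phi>) \<sigma> (\<sigma>(0 := of_bool (sat w \<sigma> \<phi>))) (cost \<phi> (length w))"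
  using assms
proof (induction \<phi> arbitrary: d \<sigma>)
  case (Read e A)
  define E where "E = tval \<sigma> e"
  have d: "d \<noteq> 0" "\<sigma> d = 0" using Read.prems by auto
  have E: "E \<le> tval (\<lambda>_. length w) e"
    unfolding E_def using Read.prems(5) by (intro tval_mono) auto
  have vars: "x \<in> tvars e \<Longrightarrow> x < d" for x using Read.prems(1) by auto
  let ?r = "of_bool (sat w \<sigma> (Read e A))"
  have "runs w (add_to e d (Suc d)) \<sigma> (\<sigma>(d := \<sigma> d + tval \<sigma> e)) (tcost e (length w))"
    using Read.prems vars by (intro runs_add_to) auto
  hence 1: "runs w (add_to e d (Suc d)) \<sigma> (\<sigma>(d := E)) (tcost e (length w))"
    by (simp add: d E_def)
  have 2: "runs w (Branch d A (Inc 0) Skip) (\<sigma>(d := E)) (\<sigma>(d := E, 0 := ?r)) (Suc 1)"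
  proof (rule runs_Branch)
    assume "sym_at w ((\<sigma>(d := E)) d) \<in> A"
    thus "runs w (Inc 0) (\<sigma>(d := E)) (\<sigma>(d := E, 0 := ?r)) 1"
      by (intro runs_weaken[OF runs_Inc]) (use d Read.prems(3) in \<open>auto simp: E_def\<close>)
  next
    assume "sym_at w ((\<sigma>(d := E)) d) \<notin> A"
    thus "runs w Skip (\<sigma>(d := E)) (\<sigma>(d := E, 0 := ?r)) 1"
      by (intro runs_weaken[OF runs_Skip]) (use d Read.prems(3) in \<open>auto simp: E_def fun_eq_iff\<close>)
  qed
  have 3: "runs w (While d nonzero (Dec d)) (\<sigma>(d := E, 0 := ?r)) (\<sigma>(0 := ?r)) (E * 2 + 1)"
    using runs_clear[of w d "\<sigma>(d := E, 0 := ?r)"]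
    by (rule runs_weaken) (use d in \<open>auto simp: fun_eq_iff\<close>)
  show ?case
    unfolding checker.simps
    by (rule runs_weaken[OF runs_Seq[OF 1 runs_Seq[OF 2 3]] refl]) (use E in simp)
next
  case (Le e f)
  define E F where "E = tval \<sigma> e" and "F = tval \<sigma> f"
  have d: "d \<noteq> 0" "\<sigma> d = 0" "\<sigma> (Suc d) = 0" using Le.prems by auto
  have E: "E \<le> tval (\<lambda>_. length w) e" and F: "F \<le> tval (\<lambda>_. length w) f"
    unfolding E_def F_def using Le.prems(5) by (auto intro: tval_mono)
  have vars: "x \<in> tvars e \<union> tvars f \<Longrightarrow> x < d" for x using Le.prems(1) by auto
  have "runs w (add_to e d (d + 2)) \<sigma> (\<sigma>(d := \<sigma> d + tval \<sigma> e)) (tcost e (length w))"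
    using Le.prems vars by (intro runs_add_to) auto
  hence 1: "runs w (add_to e d (d + 2)) \<sigma> (\<sigma>(d := E)) (tcost e (length w))"
    by (simp add: d E_def)
  have "tval (\<sigma>(d := E)) f = F"
    unfolding F_def using vars by (intro tval_cong) auto
  moreover have "runs w (add_to f (Suc d) (d + 2)) (\<sigma>(d := E))
      ((\<sigma>(d := E))(Suc d := (\<sigma>(d := E)) (Suc d) + tval (\<sigma>(d := E)) f)) (tcost f (length w))"
    using Le.prems vars by (intro runs_add_to) (auto simp: less_Suc_eq)
  ultimately have 2: "runs w (add_to f (Suc d) (d + 2)) (\<sigma>(d := E)) (\<sigma>(d := E, Suc d := F)) (tcost f (length w))"
    by (simp add: d)
  \<comment> \<open>truncated subtraction leaves 0 in counter \<open>d\<close> exactly if \<open>E \<le> F\<close>\<close>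
  define st where "st j = \<sigma>(d := E - (F - j), Suc d := j)" for j
  have "runs w (While (Suc d) nonzero (Dec (Suc d) ;; Dec d)) (st F) (st 0) (F * Suc 3 + 1)"
  proof (rule runs_countdown)
    fix j assume j: "j < F"
    show "runs w (Dec (Suc d) ;; Dec d) (st (Suc j)) (st j) 3"
      by (rule runs_weaken, (rule runs_Seq runs_Dec)+)
         (use j in \<open>auto simp: st_def fun_eq_iff\<close>)
  qed (auto simp: st_def)
  moreover have "st F = \<sigma>(d := E, Suc d := F)" "st 0 = \<sigma>(d := E - F)"
    using d by (auto simp: st_def fun_eq_iff)
  ultimately have 3: "runs w (While (Suc d) nonzero (Dec (Suc d) ;; Dec d))
      (\<sigma>(d := E, Suc d := F)) (\<sigma>(d := E - F)) (F * Suc 3 + 1)" by simp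
  let ?r = "of_bool (sat w \<sigma> (Le e f))"
  have 4: "runs w (Branch d nonzero (While d nonzero (Dec d)) (Inc 0)) (\<sigma>(d := E - F)) (\<sigma>(0 := ?r))
      (Suc (E * 2 + 1))"
  proof (rule runs_Branch)
    assume "sym_at w ((\<sigma>(d := E - F)) d) \<in> nonzero"
    hence "\<not> E \<le> F" by (simp add: sym_at_eq_mark_iff)
    thus "runs w (While d nonzero (Dec d)) (\<sigma>(d := E - F)) (\<sigma>(0 := ?r)) (E * 2 + 1)"
      by (intro runs_weaken[OF runs_clear])
         (use d Le.prems(3) in \<open>auto simp: fun_eq_iff E_def F_def\<close>)
  next
    assume "sym_at w ((\<sigma>(d := E - F)) d) \<notin> nonzero"
    hence "E \<le> F" by (simp add: sym_at_eq_mark_iff)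
    thus "runs w (Inc 0) (\<sigma>(d := E - F)) (\<sigma>(0 := ?r)) (E * 2 + 1)"
      by (intro runs_weaken[OF runs_Inc])
         (use d Le.prems(3) in \<open>auto simp: fun_eq_iff E_def F_def\<close>)
  qed
  show ?case
    unfolding checker.simps
    by (rule runs_weaken[OF runs_Seq[OF 1 runs_Seq[OF 2 runs_Seq[OF 3 4]]] refl]) (use E F in simp)
next
  case (Neg \<phi>)
  let ?r = "of_bool (sat w \<sigma> \<phi>)"
  have 1: "runs w (checker d \<phi>) \<sigma> (\<sigma>(0 := ?r)) (cost \<phi> (length w))"
    using Neg.prems by (intro Neg.IH) auto
  have 2: "runs w (Branch 0 nonzero (Dec 0) (Inc 0)) (\<sigma>(0 := ?r)) (\<sigma>(0 := of_bool (sat w \<sigma> (Neg \<phi>)))) (Suc 1)"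
  proof (rule runs_Branch)
    assume "sym_at w ((\<sigma>(0 := ?r)) 0) \<in> nonzero"
    thus "runs w (Dec 0) (\<sigma>(0 := ?r)) (\<sigma>(0 := of_bool (sat w \<sigma> (Neg \<phi>)))) 1"
      by (intro runs_weaken[OF runs_Dec]) (auto simp: sym_at_eq_mark_iff)
  next
    assume "sym_at w ((\<sigma>(0 := ?r)) 0) \<notin> nonzero"
    thus "runs w (Inc 0) (\<sigma>(0 := ?r)) (\<sigma>(0 := of_bool (sat w \<sigma> (Neg \<phi>)))) 1"
      by (intro runs_weaken[OF runs_Inc]) (auto simp: sym_at_eq_mark_iff)
  qed
  show ?case
    unfolding checker.simps
    by (rule runs_weaken[OF runs_Seq[OF 1 2] refl]) simp
next
  case (Conj \<phi> \<psi>)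
  let ?r = "of_bool (sat w \<sigma> \<phi>)" and ?s = "of_bool (sat w \<sigma> (Conj \<phi> \<psi>))"
  have 1: "runs w (checker d \<phi>) \<sigma> (\<sigma>(0 := ?r)) (cost \<phi> (length w))"
    using Conj.prems by (intro Conj.IH(1)) auto
  have 2: "runs w (Branch 0 nonzero (Dec 0 ;; checker d \<psi>) Skip) (\<sigma>(0 := ?r)) (\<sigma>(0 := ?s))
      (Suc (Suc (1 + cost \<psi> (length w))))"
  proof (rule runs_Branch)
    assume "sym_at w ((\<sigma>(0 := ?r)) 0) \<in> nonzero"
    hence \<phi>: "sat w \<sigma> \<phi>" by (auto simp: sym_at_eq_mark_iff)
    have "runs w (Dec 0) (\<sigma>(0 := ?r)) \<sigma> 1"
      by (rule runs_weaken[OF runs_Dec]) (use \<phi> Conj.prems(3) in \<open>auto simp: fun_eq_iff\<close>)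
    moreover have "runs w (checker d \<psi>) \<sigma> (\<sigma>(0 := of_bool (sat w \<sigma> \<psi>))) (cost \<psi> (length w))"
      using Conj.prems by (intro Conj.IH(2)) auto
    hence "runs w (checker d \<psi>) \<sigma> (\<sigma>(0 := ?s)) (cost \<psi> (length w))"
      by (rule runs_weaken) (use \<phi> in auto)
    ultimately show "runs w (Dec 0 ;; checker d \<psi>) (\<sigma>(0 := ?r)) (\<sigma>(0 := ?s))
        (Suc (1 + cost \<psi> (length w)))" by (rule runs_Seq)
  next
    assume "sym_at w ((\<sigma>(0 := ?r)) 0) \<notin> nonzero"
    hence "\<not> sat w \<sigma> \<phi>" by (auto simp: sym_at_eq_mark_iff)
    thus "runs w Skip (\<sigma>(0 := ?r)) (\<sigma>(0 := ?s)) (Suc (1 + cost \<psi> (length w)))"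
      by (intro runs_weaken[OF runs_Skip]) auto
  qed
  show ?case
    unfolding checker.simps
    by (rule runs_weaken[OF runs_Seq[OF 1 2] refl]) simp
next
  case (Exists x \<phi>)
  have x: "x = d" and lev: "levelled (Suc d) \<phi>" using Exists.prems(1) by auto
  have d: "d \<noteq> 0" "\<sigma> d = 0" "d \<ge> 1" using Exists.prems by auto
  let ?N = "length w"
  define Q where "Q v = sat w (\<sigma>(d := v)) \<phi>" for v
  have body: "runs w (checker (Suc d) \<phi>) (\<sigma>(d := v)) ((\<sigma>(d := v))(0 := of_bool (Q v))) (cost \<phi> ?N)"
    if "v \<le> ?N" for v
    unfolding Q_def using Exists.prems that d by (intro Exists.IH lev) auto
  have \<sigma>d: "\<sigma>(d := 0) = \<sigma>" using d by (auto simp: fun_eq_iff)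
  have "\<exists>v \<le> Suc ?N. (v = Suc ?N \<longleftrightarrow> \<not> (\<exists>u. 0 \<le> u \<and> u \<le> ?N \<and> Q u)) \<and>
      runs w (While 0 {Work 0} (checker (Suc d) \<phi> ;;
          Branch 0 {Work 0} (Inc d ;; Branch d {Blank} (Inc 0) Skip) Skip))
       \<sigma> (\<sigma>(d := v, 0 := 1)) ((Suc ?N - 0) * (cost \<phi> ?N + 7) + 1)"
    by (rule runs_search[where v = 0 and \<sigma> = \<sigma> and d = d, unfolded \<sigma>d])
       (rule body d(3) Exists.prems(3) le0 | assumption)+
  then obtain v where v: "v \<le> Suc ?N" "v = Suc ?N \<longleftrightarrow> \<not> (\<exists>u. 0 \<le> u \<and> u \<le> ?N \<and> Q u)" and
    1: "runs w (While 0 {Work 0} (checker (Suc d) \<phi> ;;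
          Branch 0 {Work 0} (Inc d ;; Branch d {Blank} (Inc 0) Skip) Skip))
       \<sigma> (\<sigma>(d := v, 0 := 1)) ((Suc ?N - 0) * (cost \<phi> ?N + 7) + 1)"
    by (elim exE conjE) (rule that)
  let ?r = "of_bool (sat w \<sigma> (Exists x \<phi>))"
  have r: "sat w \<sigma> (Exists x \<phi>) \<longleftrightarrow> v \<le> ?N"
    using v by (auto simp: x Q_def)
  have 2: "runs w (Branch d {Blank} (Dec 0) Skip) (\<sigma>(d := v, 0 := 1)) (\<sigma>(d := v, 0 := ?r)) (Suc 1)"
  proof (rule runs_Branch)
    assume "sym_at w ((\<sigma>(d := v, 0 := 1)) d) \<in> {Blank}"
    thus "runs w (Dec 0) (\<sigma>(d := v, 0 := 1)) (\<sigma>(d := v, 0 := ?r)) 1"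
      unfolding r by (intro runs_weaken[OF runs_Dec]) (use d in \<open>auto simp: sym_at_Blank\<close>)
  next
    assume "sym_at w ((\<sigma>(d := v, 0 := 1)) d) \<notin> {Blank}"
    thus "runs w Skip (\<sigma>(d := v, 0 := 1)) (\<sigma>(d := v, 0 := ?r)) 1"
      unfolding r by (intro runs_weaken[OF runs_Skip]) (use d in \<open>auto simp: sym_at_Blank\<close>)
  qed
  have 3: "runs w (While d nonzero (Dec d)) (\<sigma>(d := v, 0 := ?r)) (\<sigma>(0 := ?r)) (Suc ?N * 2 + 1)"
    by (rule runs_weaken[OF runs_clear]) (use d v(1) in \<open>auto simp: fun_eq_iff\<close>)
  show ?case
    unfolding checker.simps
    by (rule runs_weaken[OF runs_Seq[OF 1 runs_Seq[OF 2 3]] refl]) simp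
qed

text \<open>
  The loops are nested to a depth that depends on the formula only, and each of them makes
  polynomially many iterations; so first-order properties of words, with order, addition and
  multiplication on the positions, are decidable in polynomial time.
\<close>

theorem in_P_by_formula:
  fixes L :: "'a::finite list set"
  assumes "levelled 1 \<phi>" and "\<And>w. w \<in> L \<longleftrightarrow> sat w (\<lambda>_. 0) \<phi>"
  shows "in_P L"
proof (rule in_P_by_program[OF poly_bounded_cost[of \<phi>], of "checker 1 \<phi>"])
  fix w
  have "runs w (checker 1 \<phi>) (\<lambda>_. 0) ((\<lambda>_. 0)(0 := of_bool (sat w (\<lambda>_. 0) \<phi>))) (cost \<phi> (length w))"
    using assms(1) by (rule runs_checker) auto
  thus "\<exists>t \<sigma>. exec w (checker 1 \<phi>) (\<lambda>_. 0) t \<sigma> \<and> t \<le> cost \<phi> (length w) \<and> (\<sigma> 0 \<noteq> 0 \<longleftrightarrow> w \<in> L)"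
    unfolding runs_def assms(2) by fastforce
qed

section \<open>Words that encode rigid graphs\<close>

text \<open>
  Rigidity as a statement about an adjacency matrix, with all quantifiers bounded. That \<open>x\<close> is a leaf
  is expressed by saying that it has at most one neighbour; it has one by the last conjunct.
\<close>

definition matrix_rigid :: "nat \<Rightarrow> (nat \<Rightarrow> nat \<Rightarrow> bool) \<Rightarrow> bool" where
  "matrix_rigid n a \<longleftrightarrow> (\<forall>u<n. \<forall>v<n. a u v \<longrightarrow>
     (\<exists>x<n. x \<noteq> u \<and> x \<noteq> v \<and> (\<forall>y<n. \<forall>z<n. a x y \<and> a x z \<longrightarrow> y = z) \<and> (a x u \<or> a x v)))"

lemma matrix_rigid_cong:
  assumes "\<And>u v. u < n \<Longrightarrow> v < n \<Longrightarrow> a u v = b u v"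
  shows "matrix_rigid n a = matrix_rigid n b"
  unfolding matrix_rigid_def using assms by (simp cong: conj_cong)

lemma rigid_iff_matrix_rigid:
  assumes G: "simple_graph {..<n} E"
  shows "rigid E \<longleftrightarrow> matrix_rigid n (\<lambda>u v. {u, v} \<in> E)"
proof -
  have lt: "u < n" "v < n" if "{u, v} \<in> E" for u v
    using simple_graph_edgeD[OF G that] by auto
  have leaf: "leaf E x \<longleftrightarrow> (\<forall>y<n. \<forall>z<n. {x, y} \<in> E \<and> {x, z} \<in> E \<longrightarrow> y = z)"
    if "{x, u} \<in> E" for x u
  proof -
    have "leaf E x \<longleftrightarrow> (\<forall>y z. {x, y} \<in> E \<and> {x, z} \<in> E \<longrightarrow> y = z)"
      using that by (auto simp: leaf_def nbrs_def insert_commute set_eq_iff)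
    thus ?thesis using lt by blast
  qed
  \<comment> \<open>a leaf attached to an edge is a vertex below \<open>n\<close>, so bounding the quantifiers changes nothing\<close>
  define guard where "guard u v \<longleftrightarrow>
    (\<exists>x. x \<noteq> u \<and> x \<noteq> v \<and> leaf E x \<and> ({x, u} \<in> E \<or> {x, v} \<in> E))" for u v
  have "(x \<noteq> u \<and> x \<noteq> v \<and> leaf E x \<and> ({x, u} \<in> E \<or> {x, v} \<in> E)) \<longleftrightarrow>
      x < n \<and> x \<noteq> u \<and> x \<noteq> v \<and> (\<forall>y<n. \<forall>z<n. {x, y} \<in> E \<and> {x, z} \<in> E \<longrightarrow> y = z) \<and>
      ({x, u} \<in> E \<or> {x, v} \<in> E)" for x u v
  proof (cases "{x, u} \<in> E \<or> {x, v} \<in> E")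
    case True
    hence "x < n" using lt(1) by blast
    moreover have "leaf E x \<longleftrightarrow> (\<forall>y<n. \<forall>z<n. {x, y} \<in> E \<and> {x, z} \<in> E \<longrightarrow> y = z)"
      using True leaf by blast
    ultimately show ?thesis by simp
  qed simp
  hence "matrix_rigid n (\<lambda>u v. {u, v} \<in> E) \<longleftrightarrow> (\<forall>u<n. \<forall>v<n. {u, v} \<in> E \<longrightarrow> guard u v)"
    unfolding matrix_rigid_def guard_def by simp
  also have "\<dots> \<longleftrightarrow> (\<forall>u v. {u, v} \<in> E \<longrightarrow> guard u v)"
    using lt by blast
  also have "\<dots> \<longleftrightarrow> rigid E"
    by (simp add: rigid_def guard_def)
  finally show ?thesis by simp
qed

text \<open>
  The block that \<open>encode\<close> writes for vertex \<open>v\<close> if its capacity is 1, whose binary notation is a single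
  digit. All blocks have the same length \<open>n + 3\<close>, so the entries of the adjacency matrix sit at
  positions that are polynomials in \<open>n\<close> and the two vertices.
\<close>

definition row :: "nat set set \<Rightarrow> nat \<Rightarrow> nat \<Rightarrow> letter list" where
  "row E n v = map (\<lambda>u. Bit ({u, v} \<in> E)) [0..<n] @ [Sep, Bit True, Sep]"

lemma length_row: "length (row E n v) = n + 3"
  by (simp add: row_def)

lemma encode_unit:
  assumes "\<forall>x<n. \<kappa> x = 1"
  shows "encode n E \<kappa> = concat (map (row E n) [0..<n])"
proof -
  have "binary 1 = [True]" by (simp add: binary.simps)
  thus ?thesis
    unfolding encode_def using assms
    by (intro arg_cong[where f = concat] map_cong) (auto simp: row_def)
qed

lemma eq_concat_blocks_iff:
  assumes len: "\<And>v. length (f v) = m"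
  shows "w = concat (map f [0..<n]) \<longleftrightarrow>
    length w = n * m \<and> (\<forall>v<n. \<forall>j<m. w ! (v * m + j) = f v ! j)"
proof -
  have length: "length (concat (map f [0..<n])) = n * m" for n
    by (induction n) (simp_all add: len)
  have nth: "concat (map f [0..<n]) ! (v * m + j) = f v ! j" if "v < n" "j < m" for v j
    using that(1)
  proof (induction n)
    case (Suc n)
    show ?case
    proof (cases "v < n")
      case True
      have "v * m + j < Suc v * m" using that(2) by simp
      also have "\<dots> \<le> n * m" using True by (intro mult_le_mono1) simp
      finally show ?thesis using Suc True by (simp add: nth_append length)
    next
      case False
      hence "v = n" using Suc.prems by simp
      thus ?thesis by (simp add: nth_append length)
    qed
  qed simp
  show ?thesis
  proof
    assume "length w = n * m \<and> (\<forall>v<n. \<forall>j<m. w ! (v * m + j) = f v ! j)"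
    hence w: "length w = n * m" "\<And>v j. v < n \<Longrightarrow> j < m \<Longrightarrow> w ! (v * m + j) = f v ! j" by auto
    show "w = concat (map f [0..<n])"
    proof (rule nth_equalityI)
      fix i assume "i < length w"
      hence i: "i < n * m" by (simp add: w)
      hence m: "m > 0" by (cases m) auto
      have "i div m < n" "i mod m < m" using i m by (auto simp: less_mult_imp_div_less)
      thus "w ! i = concat (map f [0..<n]) ! i"
        using w(2)[of "i div m" "i mod m"] nth[of "i div m" "i mod m"] by simp
    qed (simp add: w length)
  qed (auto simp: length nth)
qed

text \<open>
  The successor accounts for the marker at position 0.
\<close>

definition entry :: "letter list \<Rightarrow> nat \<Rightarrow> nat \<Rightarrow> nat \<Rightarrow> letter cell" where
  "entry w n v j = sym_at w (Suc (v * (n + 3) + j))"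

definition well_formed :: "letter list \<Rightarrow> nat \<Rightarrow> bool" where
  "well_formed w n \<longleftrightarrow>
     (\<forall>v<n. entry w n v n = Letter Sep \<and> entry w n v (Suc n) = Letter (Bit True) \<and>
       entry w n v (Suc (Suc n)) = Letter Sep \<and>
       entry w n v v \<noteq> Letter (Bit True) \<and>
       (\<forall>u<n. entry w n v u \<in> range (Letter \<circ> Bit) \<and>
          (entry w n v u = Letter (Bit True) \<longrightarrow> entry w n u v = Letter (Bit True))))"

lemma entry_eq:
  assumes "length w = n * (n + 3)" "v < n" "j < n + 3"
  shows "entry w n v j = Letter (w ! (v * (n + 3) + j))"
proof -
  have "v * (n + 3) + j < Suc v * (n + 3)" using assms(3) by simp
  also have "\<dots> \<le> n * (n + 3)" using assms(2) by (intro mult_le_mono1) simp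
  finally show ?thesis using assms(1) by (simp add: entry_def sym_at_def)
qed

lemma less_add_3_cases:
  assumes "j < n + (3 :: nat)"
  obtains "j < n" | "j = n" | "j = Suc n" | "j = Suc (Suc n)"
  using assms by linarith

lemma row_nth:
  "j < n \<Longrightarrow> row E n v ! j = Bit ({j, v} \<in> E)"
  "row E n v ! n = Sep" "row E n v ! Suc n = Bit True" "row E n v ! Suc (Suc n) = Sep"
  by (simp_all add: row_def nth_append)

text \<open>
  From right to left, the graph is read off from the bits of the word; symmetry and an empty
  diagonal make it a simple graph whose encoding gives the word back.
\<close>

lemma graph_word_iff:
  "(\<exists>E. simple_graph {..<n} E \<and> rigid E \<and> w = concat (map (row E n) [0..<n])) \<longleftrightarrow>
   length w = n * (n + 3) \<and> well_formed w n \<and>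
   matrix_rigid n (\<lambda>u v. entry w n u v = Letter (Bit True))"
proof (intro iffI; elim exE conjE)
  fix E assume G: "simple_graph {..<n} E" and "rigid E" and "w = concat (map (row E n) [0..<n])"
  hence len: "length w = n * (n + 3)"
    and w: "\<And>v j. v < n \<Longrightarrow> j < n + 3 \<Longrightarrow> w ! (v * (n + 3) + j) = row E n v ! j"
    using eq_concat_blocks_iff[of "row E n" "n + 3" w n] by (auto simp: length_row)
  have e: "entry w n v j = Letter (row E n v ! j)" if "v < n" "j < n + 3" for v j
    using entry_eq[OF len that] w[OF that] by simp
  have adj: "entry w n v u = Letter (Bit True) \<longleftrightarrow> {v, u} \<in> E" if "v < n" "u < n" for u v
    using that by (simp add: e row_nth insert_commute)
  have "{v} \<notin> E" for v
    using simple_graph_edgeD(3)[OF G, of v v] by auto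
  hence "well_formed w n"
    unfolding well_formed_def by (auto simp: e row_nth insert_commute)
  moreover have "matrix_rigid n (\<lambda>u v. entry w n u v = Letter (Bit True))"
    using \<open>rigid E\<close> unfolding rigid_iff_matrix_rigid[OF G]
    by (subst matrix_rigid_cong[OF adj])
  ultimately show "length w = n * (n + 3) \<and> well_formed w n \<and>
      matrix_rigid n (\<lambda>u v. entry w n u v = Letter (Bit True))" using len by blast
next
  assume len: "length w = n * (n + 3)" and wf: "well_formed w n"
    and rigid: "matrix_rigid n (\<lambda>u v. entry w n u v = Letter (Bit True))"
  define a where "a u v \<longleftrightarrow> entry w n u v = Letter (Bit True)" for u v
  define E where "E = {{u, v} | u v. u < n \<and> v < n \<and> a u v}"
  have sym: "a v u" if "a u v" "u < n" "v < n" for u v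
    using that wf unfolding a_def well_formed_def by blast
  have irrefl: "\<not> a v v" if "v < n" for v
    using that wf unfolding a_def well_formed_def by blast
  have bits: "entry w n v u \<in> range (Letter \<circ> Bit)" if "v < n" "u < n" for u v
    using that wf unfolding well_formed_def by blast
  have tail: "entry w n v n = Letter Sep" "entry w n v (Suc n) = Letter (Bit True)"
    "entry w n v (Suc (Suc n)) = Letter Sep" if "v < n" for v
    using that wf unfolding well_formed_def by blast+
  have E: "{u, v} \<in> E \<longleftrightarrow> u < n \<and> v < n \<and> a u v" for u v
    using sym by (auto simp: E_def doubleton_eq_iff)
  have G: "simple_graph {..<n} E"
    using irrefl by (auto simp: simple_graph_def E_def card_insert_if)
  have "matrix_rigid n (\<lambda>u v. {u, v} \<in> E) = matrix_rigid n a"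
    by (rule matrix_rigid_cong) (simp add: E)
  hence "rigid E" using rigid unfolding rigid_iff_matrix_rigid[OF G] a_def[abs_def] by simp
  moreover have "w = concat (map (row E n) [0..<n])"
  proof (subst eq_concat_blocks_iff, rule length_row, intro conjI allI impI)
    show "length w = n * (n + 3)" by (fact len)
    fix v j assume vj: "v < n" "j < n + 3"
    have "entry w n v j = Letter (row E n v ! j)"
    proof (cases rule: less_add_3_cases[OF vj(2)])
      case 1
      obtain b where b: "entry w n v j = Letter (Bit b)" using bits[OF vj(1) 1] by auto
      have "b \<longleftrightarrow> {j, v} \<in> E"
        using b 1 vj(1) sym by (auto simp: E a_def)
      thus ?thesis using b 1 by (simp add: row_nth)
    qed (use tail[OF vj(1)] in \<open>simp_all add: row_nth\<close>)
    thus "w ! (v * (n + 3) + j) = row E n v ! j"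
      using entry_eq[OF len vj] by simp
  qed
  ultimately show "\<exists>E. simple_graph {..<n} E \<and> rigid E \<and> w = concat (map (row E n) [0..<n])"
    using G by blast
qed

section \<open>A formula for rigid graphs\<close>

text \<open>
  Variable 1 stands for the number of vertices, and vertices are the numbers below it.
\<close>

abbreviation "size_var \<equiv> Var 1"

definition width_term :: trm where
  "width_term = Succ (Succ (Succ size_var))"

definition Entry :: "trm \<Rightarrow> trm \<Rightarrow> letter cell set \<Rightarrow> letter fm" where
  "Entry e f A = Read (Succ (Add (Mul e width_term) f)) A"

abbreviation (input) "Adj e f \<equiv> Entry e f {Letter (Bit True)}"

definition Imp :: "'a fm \<Rightarrow> 'a fm \<Rightarrow> 'a fm" where
  "Imp \<phi> \<psi> = Neg (Conj \<phi> (Neg \<psi>))"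

definition Disj :: "'a fm \<Rightarrow> 'a fm \<Rightarrow> 'a fm" where
  "Disj \<phi> \<psi> = Neg (Conj (Neg \<phi>) (Neg \<psi>))"

definition Eq :: "trm \<Rightarrow> trm \<Rightarrow> 'a fm" where
  "Eq e f = Conj (Le e f) (Le f e)"

definition Some_vertex :: "nat \<Rightarrow> 'a fm \<Rightarrow> 'a fm" where
  "Some_vertex x \<phi> = Exists x (Conj (Le (Succ (Var x)) size_var) \<phi>)"

definition All_vertices :: "nat \<Rightarrow> 'a fm \<Rightarrow> 'a fm" where
  "All_vertices x \<phi> = Neg (Some_vertex x (Neg \<phi>))"

lemma tval_width_term [simp]: "tval \<sigma> width_term = \<sigma> 1 + 3"
  by (simp add: width_term_def)

lemma sat_Entry [simp]: "sat w \<sigma> (Entry e f A) \<longleftrightarrow> entry w (\<sigma> 1) (tval \<sigma> e) (tval \<sigma> f) \<in> A"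
  by (simp add: Entry_def entry_def)

lemma sat_connectives [simp]:
  "sat w \<sigma> (Imp \<phi> \<psi>) \<longleftrightarrow> (sat w \<sigma> \<phi> \<longrightarrow> sat w \<sigma> \<psi>)"
  "sat w \<sigma> (Disj \<phi> \<psi>) \<longleftrightarrow> sat w \<sigma> \<phi> \<or> sat w \<sigma> \<psi>"
  "sat w \<sigma> (Eq e f) \<longleftrightarrow> tval \<sigma> e = tval \<sigma> f"
  by (auto simp: Imp_def Disj_def Eq_def)

lemma sat_Some_vertex [simp]:
  assumes "x \<noteq> 1" "\<sigma> 1 \<le> length w"
  shows "sat w \<sigma> (Some_vertex x \<phi>) \<longleftrightarrow> (\<exists>v<\<sigma> 1. sat w (\<sigma>(x := v)) \<phi>)"
proof -
  have "v \<le> length w" if "v < \<sigma> 1" for v using that assms(2) by simp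
  thus ?thesis using assms(1) by (auto simp: Some_vertex_def Suc_le_eq)
qed

lemma sat_All_vertices [simp]:
  assumes "x \<noteq> 1" "\<sigma> 1 \<le> length w"
  shows "sat w \<sigma> (All_vertices x \<phi>) \<longleftrightarrow> (\<forall>v<\<sigma> 1. sat w (\<sigma>(x := v)) \<phi>)"
  using assms by (auto simp: All_vertices_def)

text \<open>
  The position \<open>n * (n + 3)\<close> is the last one that is not blank. This covers the empty word too, where
  that position is 0 and carries the marker.
\<close>

definition length_fm :: "letter fm" where
  "length_fm = Conj (Read (Succ (Mul size_var width_term)) {Blank})
     (Neg (Read (Mul size_var width_term) {Blank}))"

definition well_formed_fm :: "letter fm" where
  "well_formed_fm = All_vertices 2
     (Conj (Entry (Var 2) size_var {Letter Sep})
     (Conj (Adj (Var 2) (Succ size_var))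
     (Conj (Entry (Var 2) (Succ (Succ size_var)) {Letter Sep})
     (Conj (Neg (Adj (Var 2) (Var 2)))
     (All_vertices 3
       (Conj (Entry (Var 2) (Var 3) (range (Letter \<circ> Bit)))
         (Imp (Adj (Var 2) (Var 3)) (Adj (Var 3) (Var 2)))))))))"

definition rigid_fm :: "letter fm" where
  "rigid_fm = All_vertices 2 (All_vertices 3 (Imp (Adj (Var 2) (Var 3))
     (Some_vertex 4
       (Conj (Neg (Eq (Var 4) (Var 2)))
       (Conj (Neg (Eq (Var 4) (Var 3)))
       (Conj
         (All_vertices 5 (All_vertices 6
           (Imp (Conj (Adj (Var 4) (Var 5)) (Adj (Var 4) (Var 6))) (Eq (Var 5) (Var 6)))))
         (Disj (Adj (Var 4) (Var 2)) (Adj (Var 4) (Var 3)))))))))"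

definition unique_D_set_fm :: "letter fm" where
  "unique_D_set_fm = Exists 1 (Conj length_fm (Conj well_formed_fm rigid_fm))"

lemma levelled_unique_D_set_fm: "levelled 1 unique_D_set_fm"
  by (simp add: unique_D_set_fm_def length_fm_def well_formed_fm_def rigid_fm_def
      All_vertices_def Some_vertex_def Imp_def Disj_def Eq_def Entry_def width_term_def)

lemma sat_length_fm: "sat w \<sigma> length_fm \<longleftrightarrow> length w = \<sigma> 1 * (\<sigma> 1 + 3)"
  unfolding length_fm_def by (simp add: sym_at_Blank not_less) linarith

lemma sat_well_formed_fm:
  "\<sigma> 1 \<le> length w \<Longrightarrow> sat w \<sigma> well_formed_fm \<longleftrightarrow> well_formed w (\<sigma> 1)"
  by (simp add: well_formed_fm_def well_formed_def)

lemma sat_rigid_fm: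
  "\<sigma> 1 \<le> length w \<Longrightarrow>
   sat w \<sigma> rigid_fm \<longleftrightarrow> matrix_rigid (\<sigma> 1) (\<lambda>u v. entry w (\<sigma> 1) u v = Letter (Bit True))"
  by (simp add: rigid_fm_def matrix_rigid_def)

text \<open>
  The quantifier over the number of vertices is bounded by the length of the word, which loses
  nothing because \<open>n \<le> n * (n + 3)\<close>.
\<close>

lemma sat_unique_D_set_fm:
  "sat w \<sigma> unique_D_set_fm \<longleftrightarrow>
   (\<exists>n. length w = n * (n + 3) \<and> well_formed w n \<and>
      matrix_rigid n (\<lambda>u v. entry w n u v = Letter (Bit True)))"
proof -
  have "sat w (\<sigma>(1 := n)) (Conj length_fm (Conj well_formed_fm rigid_fm)) \<longleftrightarrow>
      length w = n * (n + 3) \<and> well_formed w n \<and>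
      matrix_rigid n (\<lambda>u v. entry w n u v = Letter (Bit True))" if "n \<le> length w" for n
  proof -
    have "(\<sigma>(1 := n)) 1 \<le> length w" using that by simp
    note sat_well_formed_fm[where \<sigma> = "\<sigma>(1 := n)", OF this] sat_rigid_fm[where \<sigma> = "\<sigma>(1 := n)", OF this]
    thus ?thesis unfolding sat.simps(4) sat_length_fm fun_upd_same by blast
  qed
  moreover have "n \<le> length w" if "length w = n * (n + 3)" for n
    unfolding that by simp
  ultimately show ?thesis
    unfolding unique_D_set_fm_def sat.simps(5) by blast
qed

lemma unique_D_set_words:
  "w \<in> {encode n E \<kappa> | n E \<kappa>. simple_graph {..<n} E \<and> (\<forall>x<n. \<kappa> x = 1) \<and> (\<exists>!B. D_set {..<n} E \<kappa> B)} \<longleftrightarrow>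
   (\<exists>n E. simple_graph {..<n} E \<and> rigid E \<and> w = concat (map (row E n) [0..<n]))"
  (is "w \<in> ?L \<longleftrightarrow> ?R")
proof
  assume "w \<in> ?L"
  then obtain n E \<kappa> where w: "w = encode n E \<kappa>" and G: "simple_graph {..<n} E"
    and cap: "\<forall>x<n. \<kappa> x = 1" and unique: "\<exists>!B. D_set {..<n} E \<kappa> B"
    unfolding mem_Collect_eq by (elim exE conjE) (rule that)
  have "\<forall>x\<in>{..<n}. \<kappa> x = 1" using cap by blast
  hence "rigid E" using unique by (rule iffD1[OF ex1_D_set_iff_rigid[OF G]])
  thus ?R using G w unfolding encode_unit[OF cap] by (intro exI conjI)
next
  assume ?R
  then obtain n E where G: "simple_graph {..<n} E" and "rigid E"
    and w: "w = concat (map (row E n) [0..<n])" by (elim exE conjE) (rule that)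
  define \<kappa> where "\<kappa> = (\<lambda>_ :: nat. 1 :: nat)"
  have cap: "\<forall>x<n. \<kappa> x = 1" by (simp add: \<kappa>_def)
  hence "\<forall>x\<in>{..<n}. \<kappa> x = 1" by blast
  hence "\<exists>!B. D_set {..<n} E \<kappa> B"
    using \<open>rigid E\<close> by (rule iffD2[OF ex1_D_set_iff_rigid[OF G]])
  thus "w \<in> ?L"
    using G cap w unfolding encode_unit[OF cap, symmetric] mem_Collect_eq by (intro exI conjI)
qed

theorem theorem4:
  "(\<forall>(V :: 'a set) E (\<kappa> :: 'a \<Rightarrow> nat) X Y Z.
      simple_graph V E \<and> (\<forall>x\<in>V. \<kappa> x = 1) \<and>
      X = {x \<in> V. vdegree E x = 1} \<and> Y = nbrs_set E X - X \<and> Z = V - (X \<union> Y) \<longrightarrow>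
      ((\<forall>D P F D' P' F'.
          nash_subgraph V E \<kappa> D P F \<and> nash_subgraph V E \<kappa> D' P' F' \<longrightarrow> D = D') \<longleftrightarrow>
       independent_set E (X \<union> Z) \<and> (\<forall>y\<in>Y. card (nbrs E y \<inter> X) \<ge> 2)))
   \<and> in_P {encode n E \<kappa> | n E \<kappa>.
             simple_graph {..<n} E \<and> (\<forall>x<n. \<kappa> x = 1) \<and> (\<exists>!B. D_set {..<n} E \<kappa> B)}"
proof (intro conjI allI impI; (elim conjE)?)
  fix V :: "'a set" and E and \<kappa> :: "'a \<Rightarrow> nat" and X Y Z
  assume "simple_graph V E" "\<forall>x\<in>V. \<kappa> x = 1" "X = {x \<in> V. vdegree E x = 1}"
    "Y = nbrs_set E X - X" "Z = V - (X \<union> Y)"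
  thus "(\<forall>D P F D' P' F'.
          nash_subgraph V E \<kappa> D P F \<and> nash_subgraph V E \<kappa> D' P' F' \<longrightarrow> D = D') \<longleftrightarrow>
       independent_set E (X \<union> Z) \<and> (\<forall>y\<in>Y. card (nbrs E y \<inter> X) \<ge> 2)"
    by (rule unique_D_set_iff_leaf_condition)
next
  show "in_P {encode n E \<kappa> | n E \<kappa>.
      simple_graph {..<n} E \<and> (\<forall>x<n. \<kappa> x = 1) \<and> (\<exists>!B. D_set {..<n} E \<kappa> B)}"
    by (rule in_P_by_formula[OF levelled_unique_D_set_fm])
       (simp only: unique_D_set_words graph_word_iff sat_unique_D_set_fm)
qed

end
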